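(* Let $1<\alpha\leq 2$, let $X=(X_t)_{t\geq0}$ be a scalar symmetric $\alpha$-stable Lévy process with $X_0=0$ and $\mathbb{E}[e^{iuX_t}]=e^{-|u|^{\alpha}t}$, let $T>0$, $n\in\mathbb{N}$, $\Delta_n=T/n$, $t_k=k\Delta_n$. For $-\infty\leq a\leq b\leq\infty$ let $\mathcal{O}_T([a,b])=\int_0^T\mathbf{1}_{[a,b]}(X_t)\,dt$ and $\hat{\mathcal{O}}_{T,n}([a,b])=\Delta_n\sum_{k=1}^n\mathbf{1}_{[a,b]}(X_{t_{k-1}})$. Then for sufficiently small $\varepsilon>0$ there is a constant $C<\infty$, independent of $a,b,T$ and $n$, such that \[ \Delta_n^{-1-1/\alpha}\,\bigl\|\hat{\mathcal{O}}_{T,n}([a,b])-\mathcal{O}_T([a,b])\bigr\|^2_{L^2(\mathbb{P})}\leq C\,(1\vee T^{-\varepsilon})\,T^{1-1/\alpha}. \]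
   Context: When $a=-\infty$ or $b=\infty$ the set $[a,b]$ is understood as the corresponding closed half-line (or $\mathbb{R}$). *)

theory Defs
  imports "HOL-Probability.Probability"
begin

text \<open>A scalar symmetric alpha-stable Levy process on the probability space M,
  started at 0, with E[exp(i u X_t)] = exp(-|u|^alpha t): adapted real random
  variables, X_0 = 0, cadlag paths, independent increments, and increments
  X_t - X_s (s <= t) with characteristic function exp(-|u|^alpha (t - s))
  (this encodes stationarity of increments together with the given law of X_t).\<close>
definition sas_levy :: "'w measure \<Rightarrow> real \<Rightarrow> (real \<Rightarrow> 'w \<Rightarrow> real) \<Rightarrow> bool" where
  "sas_levy M \<alpha> X \<longleftrightarrow>
     prob_space M \<and>
     (\<forall>t\<ge>0. X t \<in> borel_measurable M) \<and>
     (\<forall>\<omega>\<in>space M. X 0 \<omega> = 0) \<and>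
     (\<forall>\<omega>\<in>space M. \<forall>t\<ge>0. continuous (at_right t) (\<lambda>s. X s \<omega>)) \<and>
     (\<forall>\<omega>\<in>space M. \<forall>t>0. \<exists>l. ((\<lambda>s. X s \<omega>) \<longlongrightarrow> l) (at_left t)) \<and>
     (\<forall>(n::nat) (ts::nat \<Rightarrow> real). 0 \<le> ts 0 \<and> strict_mono ts \<longrightarrow>
        prob_space.indep_vars M (\<lambda>_. borel) (\<lambda>i \<omega>. X (ts (Suc i)) \<omega> - X (ts i) \<omega>) {..<n}) \<and>
     (\<forall>s t u. 0 \<le> s \<and> s \<le> t \<longrightarrow>
        char (distr M borel (\<lambda>\<omega>. X t \<omega> - X s \<omega>)) u = exp (- (\<bar>u\<bar> powr \<alpha>) * (t - s)))"

definition ext_Icc :: "ereal \<Rightarrow> ereal \<Rightarrow> real set" where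
  "ext_Icc a b = {x. a \<le> ereal x \<and> ereal x \<le> b}"

definition occ_time :: "(real \<Rightarrow> 'w \<Rightarrow> real) \<Rightarrow> real \<Rightarrow> real set \<Rightarrow> 'w \<Rightarrow> real" where
  "occ_time X T A \<omega> = (\<integral>t\<in>{0..T}. indicator A (X t \<omega>) \<partial>lborel)"

definition occ_est :: "(real \<Rightarrow> 'w \<Rightarrow> real) \<Rightarrow> real \<Rightarrow> nat \<Rightarrow> real set \<Rightarrow> 'w \<Rightarrow> real" where
  "occ_est X T n A \<omega> = (T / real n) * (\<Sum>k=1..n. indicator A (X (real (k - 1) * (T / real n)) \<omega>))"

end

theory Submission
  imports Defs
begin

text \<open>
  Writing the indicator of an interval as a difference of indicators of two rays reduces the claim to
  a ray \<open>A\<close> with endpoint \<open>c\<close>. With \<open>\<lfloor>s\<rfloor>\<close> the last grid point before \<open>s\<close> and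
  \<open>g s = 1_A (X s) - 1_A (X \<lfloor>s\<rfloor>)\<close>, the squared error is the double integral of \<open>E (g s * g t)\<close>
  over \<open>[0,T] \<times> [0,T]\<close>. On the event \<open>g s \<noteq> 0\<close> the path crosses \<open>c\<close>, so \<open>X \<lfloor>s\<rfloor>\<close> and \<open>X s\<close> are both within
  \<open>|Z|\<close> of \<open>c\<close>, where \<open>Z = X s - X \<lfloor>s\<rfloor>\<close>. The density of \<open>X \<lfloor>s\<rfloor>\<close> is bounded by a multiple of
  \<open>\<lfloor>s\<rfloor> powr (-1/\<alpha>)\<close>, hence \<open>E (|g s| * |Z| powr q)\<close> is at most a multiple of
  \<open>\<Delta> powr (q/\<alpha>) * (\<Delta>/s) powr (1/\<alpha>)\<close> as long as \<open>1 + q < \<alpha>\<close>.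

  For \<open>t - s > 2\<Delta>\<close> conditioning on the past of \<open>s\<close> replaces \<open>g t\<close> by the difference of the tails of
  two symmetric stable laws at \<open>c - X s\<close>, with time parameters \<open>t - s\<close> and \<open>r = \<lfloor>t\<rfloor> - s\<close>. Levy inversion
  on a symmetric interval, with \<open>|sin x| \<le> |x| powr \<beta>\<close>, bounds this difference by a multiple of
  \<open>|c - X s| powr \<beta> * \<Delta> * r powr (-1 - \<beta>/\<alpha>)\<close>. Taking \<open>0 < \<beta> < \<alpha> - 1\<close> keeps the moments finite and makes
  the bound integrable in \<open>t\<close>; it is the symmetry of the law that provides the extra factor
  \<open>r powr (-\<beta>/\<alpha>)\<close>. Integrating gives \<open>C * \<Delta> powr (1 + 1/\<alpha>) * T powr (1 - 1/\<alpha>)\<close>, even without the factor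
  \<open>max 1 (T powr (-\<epsilon>))\<close>.
\<close>

section \<open>Symmetric stable laws\<close>

text \<open>The substitution \<open>u = v / c\<close> with \<open>c = h powr (1 / \<alpha>)\<close>
  extracts the power of \<open>h\<close>. What remains is dominated by \<open>exp 1\<close> times
  the Gamma integrand, because \<open>v powr \<alpha> \<ge> v - 1\<close> once
  \<open>\<alpha> \<ge> 1\<close>.\<close>

lemma nn_integral_powr_exp_le:
  fixes p :: real
  assumes "0 < p" "1 \<le> \<alpha>" "0 < h"
  shows "(\<integral>\<^sup>+u\<in>{0<..}. ennreal (u powr (p - 1) * exp (- (u powr \<alpha>) * h)) \<partial>lborel)
    \<le> ennreal (exp 1 * Gamma p * h powr (- p / \<alpha>))"
proof -
  define c where "c = h powr (1 / \<alpha>)"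
  have c: "c > 0" "c powr \<alpha> = h" "c powr (- p) = h powr (- p / \<alpha>)"
    using assms by (auto simp: c_def powr_powr)
  have pt: "v powr (p - 1) * exp (- (v powr \<alpha>)) \<le> exp 1 * (v powr (p - 1) / exp v)"
    if "v > 0" for v :: real
  proof -
    have "- (v powr \<alpha>) \<le> 1 - v"
    proof (cases "v \<le> 1")
      case True
      then show ?thesis using powr_ge_zero[of v \<alpha>] by linarith
    next
      case False
      then have "v powr 1 \<le> v powr \<alpha>" using assms by (intro powr_mono) auto
      then show ?thesis using False by simp
    qed
    then have "exp (- (v powr \<alpha>)) \<le> exp 1 / exp v"
      by (simp add: exp_diff[symmetric])
    then have "v powr (p - 1) * exp (- (v powr \<alpha>)) \<le> v powr (p - 1) * (exp 1 / exp v)"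
      by (intro mult_left_mono) auto
    then show ?thesis by (simp add: field_simps)
  qed
  have "(\<integral>\<^sup>+u\<in>{0<..}. ennreal (u powr (p - 1) * exp (- (u powr \<alpha>) * h)) \<partial>lborel)
     = ennreal (1 / c) * (\<integral>\<^sup>+v. ennreal ((v / c) powr (p - 1) * exp (- ((v / c) powr \<alpha>) * h)) * indicator {0<..} (v / c) \<partial>lborel)"
    using c by (subst nn_integral_real_affine[where c="1 / c" and t=0]) auto
  also have "\<dots> = ennreal (1 / c) * (\<integral>\<^sup>+v. ennreal (c powr (1 - p)) * (ennreal (v powr (p - 1) * exp (- (v powr \<alpha>))) * indicator {0<..} v) \<partial>lborel)"
  proof (rule arg_cong2[where f="(*)", OF refl], rule nn_integral_cong)
    fix v :: real
    show "ennreal ((v / c) powr (p - 1) * exp (- ((v / c) powr \<alpha>) * h)) * indicator {0<..} (v / c)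
       = ennreal (c powr (1 - p)) * (ennreal (v powr (p - 1) * exp (- (v powr \<alpha>))) * indicator {0<..} v)"
      using c by (auto split: split_indicator simp: powr_divide ennreal_mult[symmetric] powr_minus[of c "p - 1", simplified] field_simps zero_less_divide_iff)
  qed
  also have "\<dots> = ennreal (1 / c) * (ennreal (c powr (1 - p)) * (\<integral>\<^sup>+v. (ennreal (v powr (p - 1) * exp (- (v powr \<alpha>))) * indicator {0<..} v) \<partial>lborel))"
    by (subst nn_integral_cmult) auto
  also have "\<dots> = ennreal (1 / c * c powr (1 - p)) * (\<integral>\<^sup>+v. (ennreal (v powr (p - 1) * exp (- (v powr \<alpha>))) * indicator {0<..} v) \<partial>lborel)"
    using c by (subst ennreal_mult) (simp_all add: mult.assoc less_imp_le)
  also have "1 / c * c powr (1 - p) = h powr (- p / \<alpha>)"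
    using c by (simp add: powr_diff powr_minus field_simps flip: c(3))
  also have "ennreal (h powr (- p / \<alpha>)) * (\<integral>\<^sup>+v. (ennreal (v powr (p - 1) * exp (- (v powr \<alpha>))) * indicator {0<..} v) \<partial>lborel)
      \<le> ennreal (h powr (- p / \<alpha>)) * (ennreal (exp 1) * ennreal (Gamma p))"
  proof (rule mult_left_mono)
    have "(\<integral>\<^sup>+v. (ennreal (v powr (p - 1) * exp (- (v powr \<alpha>))) * indicator {0<..} v) \<partial>lborel)
        \<le> (\<integral>\<^sup>+v. ennreal (exp 1) * ennreal (indicator {0..} v * v powr (p - 1) / exp v) \<partial>lborel)"
      using pt by (intro nn_integral_mono) (auto split: split_indicator simp: ennreal_mult[symmetric] intro!: ennreal_leI)
    also have "\<dots> = ennreal (exp 1) * ennreal (Gamma p)"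
      using Gamma_conv_nn_integral_real[OF assms(1)] by (subst nn_integral_cmult) auto
    finally show "(\<integral>\<^sup>+v. (ennreal (v powr (p - 1) * exp (- (v powr \<alpha>))) * indicator {0<..} v) \<partial>lborel)
        \<le> ennreal (exp 1) * ennreal (Gamma p)" .
  qed simp
  also have "\<dots> = ennreal (exp 1 * Gamma p * h powr (- p / \<alpha>))"
    using Gamma_real_pos[OF assms(1)] by (simp add: ennreal_mult[symmetric] mult_ac)
  finally show ?thesis .
qed

text \<open>Levy inversion only yields a limit of integrals over \<open>(-n, n)\<close>. An even
  majorant with finite integral over the half line bounds all of them at once, hence also the limit.
  The point 0 is left out because the inversion kernel divides by \<open>t\<close>.\<close>

lemma norm_limit_symmetric_integral_le:
  fixes k :: "real \<Rightarrow> complex"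
  assumes lim: "(\<lambda>n::nat. CLBINT t=-real n..real n. k t) \<longlonglongrightarrow> L"
    and bnd: "\<And>t. t \<noteq> 0 \<Longrightarrow> norm (k t) \<le> w \<bar>t\<bar>"
    and w[measurable]: "w \<in> borel_measurable borel"
    and W: "(\<integral>\<^sup>+t\<in>{0<..}. ennreal (w t) \<partial>lborel) \<le> ennreal W" "0 \<le> W"
  shows "norm L \<le> 2 * W"
proof -
  have le: "norm (CLBINT t=-real n..real n. k t) \<le> 2 * W" for n
  proof -
    let ?g = "\<lambda>t. indicator {-real n<..<real n} t *\<^sub>R k t"
    have eq: "(CLBINT t=-real n..real n. k t) = integral\<^sup>L lborel ?g"
      by (simp add: interval_lebesgue_integral_def set_lebesgue_integral_def)
    show ?thesis
    proof (cases "integrable lborel ?g")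
      \<comment> \<open>The integral of a function that is not integrable is 0 by convention, so the
        bound is immediate.\<close>
      case False
      then show ?thesis using W eq by (simp add: not_integrable_integral_eq)
    next
      case True
      have "ennreal (norm (integral\<^sup>L lborel ?g)) \<le> (\<integral>\<^sup>+t. ennreal (norm (?g t)) \<partial>lborel)"
        by (rule integral_norm_bound_ennreal[OF True])
      also have "\<dots> \<le> (\<integral>\<^sup>+t. ennreal (w t) * indicator {0<..} t + ennreal (w (- t)) * indicator {0<..} (- t) \<partial>lborel)"
      proof (intro nn_integral_mono_AE)
        have "AE t in lborel. t \<noteq> (0::real)" by (rule AE_lborel_singleton)
        then show "AE t in lborel. ennreal (norm (?g t)) \<le>
           ennreal (w t) * indicator {0<..} t + ennreal (w (- t)) * indicator {0<..} (- t)"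
        proof eventually_elim
          case (elim t)
          have "ennreal (norm (?g t)) \<le> ennreal (w \<bar>t\<bar>)"
            using bnd[OF elim] order_trans[OF norm_ge_zero bnd[OF elim]]
            by (intro ennreal_leI) (auto split: split_indicator)
          then show ?case using elim by (cases "t > 0") auto
        qed
      qed
      also have "\<dots> = (\<integral>\<^sup>+t. ennreal (w t) * indicator {0<..} t \<partial>lborel) + (\<integral>\<^sup>+t. ennreal (w (- t)) * indicator {0<..} (- t) \<partial>lborel)"
        by (intro nn_integral_add) auto
      also have "(\<integral>\<^sup>+t. ennreal (w (- t)) * indicator {0<..} (- t) \<partial>lborel) = (\<integral>\<^sup>+t. ennreal (w t) * indicator {0<..} t \<partial>lborel)"
        by (subst (2) nn_integral_real_affine[where c="-1" and t=0]) auto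
      also have "(\<integral>\<^sup>+t. ennreal (w t) * indicator {0<..} t \<partial>lborel) + (\<integral>\<^sup>+t. ennreal (w t) * indicator {0<..} t \<partial>lborel) \<le> ennreal W + ennreal W"
        using W by (intro add_mono) auto
      also have "\<dots> = ennreal (2 * W)"
        using W by (simp flip: ennreal_plus)
      finally show ?thesis using W eq by (simp add: ennreal_le_iff)
    qed
  qed
  show ?thesis
    by (rule Lim_norm_ubound[OF _ lim]) (auto intro: always_eventually le)
qed

text \<open>A law has at most countably many atoms, while an open interval is uncountable. The
  points obtained serve as endpoints in Levy inversion.\<close>

lemma continuity_points_exist:
  assumes "real_distribution N" "c < d"
  obtains x where "c < x" "x < d" "measure N {x} = 0"
proof -
  interpret real_distribution N by fact
  have "\<not> {c<..<d} \<subseteq> {x. measure N {x} \<noteq> 0}"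
    using countable_subset[OF _ countable_support] uncountable_open_interval assms(2) by blast
  then show ?thesis using that by auto
qed

lemma (in real_distribution) Levy_Inversion':
  assumes "a \<le> b" "measure M {a} = 0" "measure M {b} = 0"
  shows "(\<lambda>n::nat. CLBINT t=-real n..real n. (iexp (-(t * a)) - iexp (-(t * b))) / (\<i> * t) * char M t)
    \<longlonglongrightarrow> complex_of_real (measure M {a<..b} * (2 * pi))"
proof -
  have "(\<lambda>n::nat. (1 / (2 * pi) * (CLBINT t=-real n..real n. (iexp (-(t * a)) - iexp (-(t * b))) / (\<i> * t) * char M t)) * (2 * pi))
    \<longlonglongrightarrow> complex_of_real (measure M {a<..b}) * (2 * pi)"
    using Levy_Inversion[OF assms] by (intro tendsto_mult_right) simp
  then show ?thesis by simp
qed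

section \<open>Stable laws and the mass of intervals\<close>

text \<open>The parameter \<open>h\<close> is a time span: this is the law of an increment of the
  process over a time interval of length \<open>h\<close>.\<close>

definition stable_law :: "real \<Rightarrow> real \<Rightarrow> real measure \<Rightarrow> bool" where
  "stable_law \<alpha> h N \<longleftrightarrow> real_distribution N \<and>
     (\<forall>u. char N u = complex_of_real (exp (- (\<bar>u\<bar> powr \<alpha>) * h)))"

text \<open>This is the density bound of order \<open>h powr (- 1 / \<alpha>)\<close> in integrated
  form. The inversion kernel of \<open>(a, b]\<close> has modulus at most \<open>b - a\<close>, and
  the modulus of the characteristic function is integrated by the case \<open>p = 1\<close> of the
  Gamma estimate. Arbitrary endpoints are reached by widening the interval slightly to endpoints
  that carry no atom.\<close>

lemma stable_law_interval_le:
  assumes N: "stable_law \<alpha> h N" and "1 \<le> \<alpha>" "0 < h" "c \<le> d"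
  shows "measure N {c..d} \<le> exp 1 * h powr (- 1 / \<alpha>) * (d - c)"
proof -
  interpret real_distribution N using N by (simp add: stable_law_def)
  have rd: "real_distribution N" by unfold_locales
  have aux: "measure N {a<..b} \<le> exp 1 * h powr (- 1 / \<alpha>) * (b - a)"
    if ab: "a \<le> b" "measure N {a} = 0" "measure N {b} = 0" for a b
  proof -
    let ?k = "\<lambda>t. (iexp (-(t * a)) - iexp (-(t * b))) / (\<i> * t) * char N t"
    let ?L = "complex_of_real (measure N {a<..b} * (2 * pi))"
    have lim: "(\<lambda>n::nat. CLBINT t=-real n..real n. ?k t) \<longlonglongrightarrow> ?L"
      by (rule Levy_Inversion'[OF ab])
    have "norm ?L \<le> 2 * ((b - a) * (exp 1 * Gamma 1 * h powr (- 1 / \<alpha>)))"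
    proof (rule norm_limit_symmetric_integral_le[OF lim, where w="\<lambda>t. (b - a) * exp (- (t powr \<alpha>) * h)"])
      fix t :: real assume t: "t \<noteq> 0"
      have "cmod ((iexp (-(t * a)) - iexp (-(t * b))) / (\<i> * t)) \<le> b - a"
        using Levy_Inversion_aux2[of "-b" "-a" t] ab t by (simp add: mult_minus_right)
      moreover have "norm (char N t) = exp (- (\<bar>t\<bar> powr \<alpha>) * h)"
        using N by (simp add: stable_law_def del: of_real_exp)
      ultimately show "norm (?k t) \<le> (b - a) * exp (- (\<bar>t\<bar> powr \<alpha>) * h)"
        by (simp only: norm_mult) (intro mult_right_mono, auto)
    next
      have "(\<integral>\<^sup>+t\<in>{0<..}. ennreal ((b - a) * exp (- (t powr \<alpha>) * h)) \<partial>lborel)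
         = (\<integral>\<^sup>+t. ennreal (b - a) * (ennreal (t powr (1 - 1) * exp (- (t powr \<alpha>) * h)) * indicator {0<..} t) \<partial>lborel)"
        using ab by (intro nn_integral_cong) (auto split: split_indicator simp: ennreal_mult)
      also have "\<dots> = ennreal (b - a) * (\<integral>\<^sup>+t\<in>{0<..}. ennreal (t powr (1 - 1) * exp (- (t powr \<alpha>) * h)) \<partial>lborel)"
        by (intro nn_integral_cmult) auto
      also have "\<dots> \<le> ennreal (b - a) * ennreal (exp 1 * Gamma 1 * h powr (- 1 / \<alpha>))"
        by (intro mult_left_mono nn_integral_powr_exp_le) (use assms in auto)
      finally show "(\<integral>\<^sup>+t\<in>{0<..}. ennreal ((b - a) * exp (- (t powr \<alpha>) * h)) \<partial>lborel)
          \<le> ennreal ((b - a) * (exp 1 * Gamma 1 * h powr (- 1 / \<alpha>)))"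
        using ab by (simp add: ennreal_mult)
    qed (use ab in auto)
    then have "measure N {a<..b} * (2 * pi) \<le> 2 * ((b - a) * (exp 1 * h powr (- 1 / \<alpha>)))"
      by (simp add: norm_mult)
    \<comment> \<open>The factor \<open>pi\<close> is given away to keep the constant
      simple.\<close>
    moreover have "measure N {a<..b} * 2 \<le> measure N {a<..b} * (2 * pi)"
      using pi_gt3 by (intro mult_left_mono) auto
    ultimately show ?thesis by (simp add: mult_ac)
  qed
  show ?thesis
  proof (rule field_le_epsilon)
    fix e :: real assume e: "e > 0"
    define K where "K = exp 1 * h powr (- 1 / \<alpha>)"
    have K: "K > 0" using assms by (auto simp: K_def)
    \<comment> \<open>Widening the interval by at most \<open>r\<close> on each side costs at most
      \<open>2 * r * K = e\<close>.\<close>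
    define r where "r = e / (2 * K)"
    have r: "r > 0" using K e by (auto simp: r_def)
    obtain a where a: "c - r < a" "a < c" "measure N {a} = 0"
      using continuity_points_exist[OF rd, of "c - r" c] r by auto
    obtain b where b: "d < b" "b < d + r" "measure N {b} = 0"
      using continuity_points_exist[OF rd, of d "d + r"] r by auto
    have "measure N {c..d} \<le> measure N {a<..b}"
      using a b by (intro finite_measure_mono) auto
    also have "\<dots> \<le> K * (b - a)" unfolding K_def using a b assms by (intro aux) auto
    also have "\<dots> \<le> K * ((d - c) + 2 * r)" using K a b by (intro mult_left_mono) auto
    also have "\<dots> = K * (d - c) + e" using K by (simp add: r_def field_simps)
    finally show "measure N {c..d} \<le> exp 1 * h powr (- 1 / \<alpha>) * (d - c) + e" by (simp add: K_def)
  qed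
qed

text \<open>The degenerate interval has length 0 in the previous estimate. Every point is thereby an
  admissible endpoint for Levy inversion.\<close>

lemma stable_law_singleton:
  assumes "stable_law \<alpha> h N" "1 \<le> \<alpha>" "0 < h"
  shows "measure N {c} = 0"
proof (rule antisym)
  have "measure N {c..c} \<le> exp 1 * h powr (- 1 / \<alpha>) * (c - c)"
    by (rule stable_law_interval_le[OF assms order_refl])
  then show "measure N {c} \<le> 0" by (simp only: diff_self mult_zero_right atLeastAtMost_singleton)
qed (rule measure_nonneg)

section \<open>Absolute moments of stable laws\<close>

lemma nn_integral_powr_from_0:
  fixes a c :: real
  assumes "-1 < a" "0 \<le> c"
  shows "(\<integral>\<^sup>+x\<in>{0..c}. ennreal (x powr a) \<partial>lborel) = ennreal (c powr (a + 1) / (a + 1))"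
  by (rule nn_integral_has_integral_lebesgue'[OF _ has_integral_powr_from_0[OF assms]]) simp

lemma nn_integral_powr_to_inf:
  fixes a e :: real
  assumes "e < -1" "0 < a"
  shows "(\<integral>\<^sup>+x\<in>{a..}. ennreal (x powr e) \<partial>lborel) = ennreal (- (a powr (e + 1)) / (e + 1))"
  by (rule nn_integral_has_integral_lebesgue'[OF _ has_integral_powr_to_inf[OF assms]]) simp

text \<open>Integrated against a law, this bounds absolute moments by the real part of the characteristic function.\<close>
lemma abs_powr_le_nn_integral_cos:
  fixes q z :: real
  assumes "0 < q"
  shows "ennreal ((1 - cos 1) * 2 powr (- 1 - q) * \<bar>z\<bar> powr q)
    \<le> (\<integral>\<^sup>+u\<in>{0<..}. ennreal ((1 - cos (u * z)) * u powr (- 1 - q)) \<partial>lborel)"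
proof (cases "z = 0")
  case False
  define y where "y = \<bar>z\<bar>"
  have y: "y > 0" using False by (simp add: y_def)
  \<comment> \<open>It is enough to integrate over \<open>[1/y, 2/y]\<close>, of length
    \<open>1 / y\<close>. There \<open>u * y\<close> lies in \<open>[1, 2]\<close>, so its cosine is
    at most \<open>cos 1\<close> because \<open>2 < pi\<close>, and the weight is at least its value
    at \<open>2 / y\<close>.\<close>
  have "ennreal ((1 - cos 1) * 2 powr (- 1 - q) * y powr q)
     = ennreal ((1 - cos 1) * (2 / y) powr (- 1 - q)) * emeasure lborel {1/y..2/y}"
  proof -
    have "(2 / y) powr (- 1 - q) * (1 / y) = 2 powr (- 1 - q) * y powr q"
      using y by (simp add: powr_divide powr_diff powr_minus field_simps)
    then have 1: "(1 - cos 1) * 2 powr (- 1 - q) * y powr q = (1 - cos 1) * (2 / y) powr (- 1 - q) * (1 / y)"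
      by (simp only: mult.assoc)
    have 2: "emeasure lborel {1/y..2/y} = ennreal (1 / y)"
      using y by (simp add: divide_right_mono diff_divide_distrib[symmetric])
    show ?thesis
      unfolding 1 2 using y by (intro ennreal_mult) auto
  qed
  also have "\<dots> = (\<integral>\<^sup>+u. ennreal ((1 - cos 1) * (2 / y) powr (- 1 - q)) * indicator {1/y..2/y} u \<partial>lborel)"
    by (subst nn_integral_cmult_indicator) auto
  also have "\<dots> \<le> (\<integral>\<^sup>+u\<in>{0<..}. ennreal ((1 - cos (u * z)) * u powr (- 1 - q)) \<partial>lborel)"
  proof (intro nn_integral_mono)
    fix u :: real
    show "ennreal ((1 - cos 1) * (2 / y) powr (- 1 - q)) * indicator {1/y..2/y} u
      \<le> ennreal ((1 - cos (u * z)) * u powr (- 1 - q)) * indicator {0<..} u"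
    proof (cases "u \<in> {1/y..2/y}")
      case True
      then have u: "u > 0" "1 \<le> u * y" "u * y \<le> 2" using y by (auto simp: field_simps intro: less_le_trans[of 0 "1 / y"])
      have "cos (u * z) = cos (u * y)"
        using cos_abs_real[of "u * z"] u by (simp add: y_def abs_mult)
      also have "\<dots> \<le> cos 1"
        using u pi_gt3 by (intro cos_monotone_0_pi_le) auto
      finally have c: "1 - cos 1 \<le> 1 - cos (u * z)" by simp
      have "(2 / y) powr (- 1 - q) \<le> u powr (- 1 - q)"
        using u True assms by (intro powr_mono2') auto
      with c have "(1 - cos 1) * (2 / y) powr (- 1 - q) \<le> (1 - cos (u * z)) * u powr (- 1 - q)"
        by (intro mult_mono) auto
      then show ?thesis using True u by (simp add: ennreal_leI)
    qed auto
  qed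
  finally show ?thesis by (simp add: y_def)
qed auto

text \<open>Fubini turns the moment into the integral of one minus the characteristic function
  against \<open>u powr (- 1 - q)\<close>. Near 0 the inequality
  \<open>1 - exp (- x) \<le> x\<close> gives convergence because \<open>q < \<alpha>\<close>; near
  infinity the bound by 1 suffices because \<open>0 < q\<close>.\<close>

lemma stable_law_moment:
  assumes N: "stable_law \<alpha> h N" and "0 < q" "q < \<alpha>" "0 < h"
  shows "(\<integral>\<^sup>+z. ennreal (\<bar>z\<bar> powr q) \<partial>N)
    \<le> ennreal ((1 / (\<alpha> - q) + 1 / q) / ((1 - cos 1) * 2 powr (- 1 - q)) * h powr (q / \<alpha>))"
proof -
  interpret real_distribution N using N by (simp add: stable_law_def)
  have \<alpha>: "\<alpha> > 0" using assms by simp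
  define c where "c = (1 - cos (1::real)) * 2 powr (- 1 - q)"
  have c: "c > 0"
    using cos_monotone_0_pi[of 0 1] pi_gt3 by (simp add: c_def)
  \<comment> \<open>At this splitting point \<open>r powr \<alpha> * h = 1\<close>, so the two
    bounds \<open>u powr \<alpha> * h\<close> and 1 agree and both pieces scale like
    \<open>h powr (q / \<alpha>)\<close>.\<close>
  define r where "r = h powr (- 1 / \<alpha>)"
  have r: "r > 0" using assms by (simp add: r_def)
  interpret P: pair_sigma_finite N lborel ..
  have "ennreal c * (\<integral>\<^sup>+z. ennreal (\<bar>z\<bar> powr q) \<partial>N) = (\<integral>\<^sup>+z. ennreal (c * \<bar>z\<bar> powr q) \<partial>N)"
    using c by (subst nn_integral_cmult[symmetric]) (auto simp: ennreal_mult)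
  also have "\<dots> \<le> (\<integral>\<^sup>+z. (\<integral>\<^sup>+u\<in>{0<..}. ennreal ((1 - cos (u * z)) * u powr (- 1 - q)) \<partial>lborel) \<partial>N)"
    unfolding c_def by (intro nn_integral_mono abs_powr_le_nn_integral_cos assms)
  also have "\<dots> = (\<integral>\<^sup>+u. (\<integral>\<^sup>+z. ennreal ((1 - cos (u * z)) * u powr (- 1 - q)) * indicator {0<..} u \<partial>N) \<partial>lborel)"
    by (intro P.Fubini'[symmetric]) auto
  also have "\<dots> \<le> (\<integral>\<^sup>+u. ennreal h * (ennreal (u powr (\<alpha> - 1 - q)) * indicator {0..r} u)
      + ennreal (u powr (- 1 - q)) * indicator {r..} u \<partial>lborel)"
  proof (intro nn_integral_mono)
    fix u :: real
    show "(\<integral>\<^sup>+z. ennreal ((1 - cos (u * z)) * u powr (- 1 - q)) * indicator {0<..} u \<partial>N)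
     \<le> ennreal h * (ennreal (u powr (\<alpha> - 1 - q)) * indicator {0..r} u)
      + ennreal (u powr (- 1 - q)) * indicator {r..} u"
    proof (cases "u > 0")
      case True
      have ic: "integrable N (\<lambda>z. cos (u * z))"
        by (rule integrable_const_bound[where B=1]) auto
      have "exp (- (u powr \<alpha>) * h) = Re (char N u)"
        using N True by (simp add: stable_law_def del: of_real_exp)
      also have "\<dots> = (\<integral>z. Re (iexp (u * z)) \<partial>N)"
        unfolding char_def using integrable_iexp[of "\<lambda>z. u * z"] by (intro integral_Re[symmetric]) auto
      also have "\<dots> = (\<integral>z. cos (u * z) \<partial>N)" by (simp add: Re_exp)
      finally have cs: "(\<integral>z. cos (u * z) \<partial>N) = exp (- (u powr \<alpha>) * h)" ..
      have "(\<integral>\<^sup>+z. ennreal ((1 - cos (u * z)) * u powr (- 1 - q)) * indicator {0<..} u \<partial>N)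
        = (\<integral>\<^sup>+z. ennreal ((1 - cos (u * z)) * u powr (- 1 - q)) \<partial>N)"
        using True by simp
      also have "\<dots> = ennreal (\<integral>z. (1 - cos (u * z)) * u powr (- 1 - q) \<partial>N)"
        using ic by (intro nn_integral_eq_integral) auto
      also have "(\<integral>z. (1 - cos (u * z)) * u powr (- 1 - q) \<partial>N) = (1 - exp (- (u powr \<alpha>) * h)) * u powr (- 1 - q)"
        using ic cs prob_space by simp
      finally have eq: "(\<integral>\<^sup>+z. ennreal ((1 - cos (u * z)) * u powr (- 1 - q)) * indicator {0<..} u \<partial>N)
         = ennreal ((1 - exp (- (u powr \<alpha>) * h)) * u powr (- 1 - q))" .
      show ?thesis
      proof (cases "u \<le> r")
        case True
        have "1 - exp (- (u powr \<alpha>) * h) \<le> u powr \<alpha> * h"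
          using exp_ge_add_one_self[of "- (u powr \<alpha>) * h"] by simp
        then have "(1 - exp (- (u powr \<alpha>) * h)) * u powr (- 1 - q) \<le> u powr \<alpha> * h * u powr (- 1 - q)"
          by (intro mult_right_mono) auto
        also have "\<dots> = h * u powr (\<alpha> - 1 - q)"
          using powr_add[of u \<alpha> "- 1 - q"] by (simp add: algebra_simps)
        finally have "ennreal ((1 - exp (- (u powr \<alpha>) * h)) * u powr (- 1 - q)) \<le> ennreal h * ennreal (u powr (\<alpha> - 1 - q))"
          using assms by (simp add: ennreal_mult[symmetric] ennreal_leI)
        then show ?thesis using True \<open>u > 0\<close> unfolding eq by (auto split: split_indicator intro: order_trans add_increasing2)
      next
        case False
        have "(1 - exp (- (u powr \<alpha>) * h)) * u powr (- 1 - q) \<le> 1 * u powr (- 1 - q)"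
          by (intro mult_right_mono) auto
        then show ?thesis using False unfolding eq by (simp add: ennreal_leI)
      qed
    qed auto
  qed
  also have "\<dots> = (\<integral>\<^sup>+u. ennreal h * (ennreal (u powr (\<alpha> - 1 - q)) * indicator {0..r} u) \<partial>lborel)
      + (\<integral>\<^sup>+u. ennreal (u powr (- 1 - q)) * indicator {r..} u \<partial>lborel)"
    by (intro nn_integral_add) auto
  also have "(\<integral>\<^sup>+u. ennreal h * (ennreal (u powr (\<alpha> - 1 - q)) * indicator {0..r} u) \<partial>lborel)
     = ennreal h * ennreal (r powr (\<alpha> - q) / (\<alpha> - q))"
    using nn_integral_powr_from_0[of "\<alpha> - 1 - q" r] r assms by (subst nn_integral_cmult) auto
  also have "(\<integral>\<^sup>+u. ennreal (u powr (- 1 - q)) * indicator {r..} u \<partial>lborel) = ennreal (r powr (- q) / q)"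
    using nn_integral_powr_to_inf[of "- 1 - q" r] r assms by simp
  also have "ennreal h * ennreal (r powr (\<alpha> - q) / (\<alpha> - q)) + ennreal (r powr (- q) / q)
     = ennreal (h * r powr (\<alpha> - q) / (\<alpha> - q) + r powr (- q) / q)"
    using assms by (simp add: ennreal_mult[symmetric] ennreal_plus[symmetric] del: ennreal_plus)
  also have "h * r powr (\<alpha> - q) / (\<alpha> - q) + r powr (- q) / q = (1 / (\<alpha> - q) + 1 / q) * h powr (q / \<alpha>)"
  proof -
    have "r powr (- q) = h powr (q / \<alpha>)"
      using assms by (simp add: r_def powr_powr)
    moreover have "h * r powr (\<alpha> - q) = h powr 1 * h powr ((- 1 / \<alpha>) * (\<alpha> - q))"
      using assms by (simp add: r_def powr_powr)
    moreover have "\<dots> = h powr (q / \<alpha>)"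
      using \<alpha> by (subst powr_add[symmetric]) (simp add: field_simps)
    ultimately show ?thesis by (simp add: field_simps)
  qed
  finally have *: "ennreal c * (\<integral>\<^sup>+z. ennreal (\<bar>z\<bar> powr q) \<partial>N) \<le> ennreal ((1 / (\<alpha> - q) + 1 / q) * h powr (q / \<alpha>))" .
  have "(\<integral>\<^sup>+z. ennreal (\<bar>z\<bar> powr q) \<partial>N) = ennreal (1 / c) * (ennreal c * (\<integral>\<^sup>+z. ennreal (\<bar>z\<bar> powr q) \<partial>N))"
    using c by (simp add: mult.assoc[symmetric] ennreal_mult[symmetric])
  also have "\<dots> \<le> ennreal (1 / c) * ennreal ((1 / (\<alpha> - q) + 1 / q) * h powr (q / \<alpha>))"
    by (intro mult_left_mono *) auto
  also have "\<dots> = ennreal ((1 / (\<alpha> - q) + 1 / q) / c * h powr (q / \<alpha>))"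
    using c assms by (simp add: ennreal_mult[symmetric])
  finally show ?thesis by (simp add: c_def)
qed

section \<open>Symmetry and the comparison of two tails\<close>

text \<open>The characteristic function is even, and it determines the law.\<close>

lemma stable_law_reflect:
  assumes N: "stable_law \<alpha> h N"
  shows "distr N borel uminus = N"
proof (rule Levy_uniqueness)
  interpret real_distribution N using N by (simp add: stable_law_def)
  show "real_distribution (distr N borel uminus)"
    by (rule real_distribution_distr) simp
  show "real_distribution N" by unfold_locales
  show "char (distr N borel uminus) = char N"
  proof
    fix u
    have "char (distr N borel uminus) u = char N (- u)"
      by (simp add: char_def integral_distr)
    then show "char (distr N borel uminus) u = char N u"
      using N by (simp add: stable_law_def)
  qed
qed

text \<open>Inversion works on bounded intervals, and on a symmetric one its kernel is a sine; this
  formula moves a ray there. By reflection the two rays outside the symmetric interval have equal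
  mass, and the absence of atoms makes open and closed endpoints interchangeable. The sign of
  \<open>c\<close> tells whether the interval lies outside the ray or is part of it.\<close>

lemma stable_law_tail:
  assumes N: "stable_law \<alpha> h N" "1 \<le> \<alpha>" "0 < h" and A: "A = {c..} \<or> A = {c<..}"
  shows "measure N A = (1 - sgn c * measure N {- \<bar>c\<bar><..\<bar>c\<bar>}) / 2"
proof -
  interpret real_distribution N using N by (simp add: stable_law_def)
  have refl: "measure N (uminus -` B) = measure N B" if [measurable]: "B \<in> sets borel" for B :: "real set"
    using measure_distr[of uminus N borel B] stable_law_reflect[OF N(1)] by simp
  have s0: "measure N {x} = 0" for x by (rule stable_law_singleton[OF N])
  have ray: "measure N {x..} = measure N {x<..}" for x
  proof -
    have "{x..} = {x} \<union> {x<..}" by auto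
    moreover have "measure N ({x} \<union> {x<..}) = measure N {x} + measure N {x<..}"
      by (rule finite_measure_Union) auto
    ultimately show ?thesis using s0[of x] by simp
  qed
  have pos: "measure N {x<..} = (1 - measure N {- x<..x}) / 2" if "x \<ge> 0" for x
  proof -
    have "UNIV = {..- x} \<union> {- x<..x} \<union> {x<..}" by auto
    then have "1 = measure N ({..- x} \<union> {- x<..x} \<union> {x<..})" using prob_space by simp
    also have "\<dots> = measure N {..- x} + measure N {- x<..x} + measure N {x<..}"
      using that by (subst finite_measure_Union; auto)+
    also have "measure N {..- x} = measure N {x..}"
    proof -
      have "uminus -` {x..} = {..- x}" by auto
      then show ?thesis using refl[of "{x..}"] by simp
    qed
    finally show ?thesis by (simp add: ray)
  qed
  have A': "measure N A = measure N {c<..}" using A ray by auto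
  show ?thesis
  proof (cases "c \<ge> 0")
    case True
    then show ?thesis
      unfolding A' pos[OF True] by (cases "c = 0") auto
  next
    case False
    have "UNIV = {..c} \<union> {c<..}" by auto
    then have "1 = measure N ({..c} \<union> {c<..})" using prob_space by simp
    also have "\<dots> = measure N {..c} + measure N {c<..}"
      by (subst finite_measure_Union) auto
    also have "measure N {..c} = measure N {- c..}"
    proof -
      have "uminus -` {- c..} = {..c}" by auto
      then show ?thesis using refl[of "{- c..}"] by simp
    qed
    also have "\<dots> = (1 - measure N {c<..- c}) / 2"
      using pos[of "- c"] ray False by simp
    finally show ?thesis using False unfolding A' by (simp add: field_simps)
  qed
qed

text \<open>This interpolates between the bounds \<open>|x|\<close> and 1. The exponent
  \<open>\<beta>\<close> decides how much of the distance to the endpoint is traded for decay in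
  time.\<close>

lemma abs_sin_le_powr:
  fixes x \<beta> :: real
  assumes "0 < \<beta>" "\<beta> \<le> 1"
  shows "\<bar>sin x\<bar> \<le> \<bar>x\<bar> powr \<beta>"
proof (cases "\<bar>x\<bar> \<le> 1")
  case True
  have "\<bar>sin x\<bar> \<le> \<bar>x\<bar>" by (rule abs_sin_x_le_abs_x)
  also have "\<dots> = \<bar>x\<bar> powr 1" by simp
  also have "\<dots> \<le> \<bar>x\<bar> powr \<beta>" using True assms by (intro powr_mono') auto
  finally show ?thesis .
next
  case False
  then have "1 \<le> \<bar>x\<bar> powr \<beta>" using assms by (intro ge_one_powr_ge_zero) auto
  then show ?thesis using abs_sin_le_one[of x] by linarith
qed

text \<open>Both tails are expressed through the interval \<open>(-z, z]\<close> with
  \<open>z = |c|\<close>. There the kernel is at most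
  \<open>2 * z powr \<beta> * |u| powr (\<beta> - 1)\<close>, and the characteristic functions
  differ by at most \<open>(t - r) * |u| powr \<alpha> * exp (- (|u| powr \<alpha>) * r)\<close>.
  The product is a Gamma integrand with \<open>p = \<alpha> + \<beta>\<close>, whose integral scales
  like \<open>r powr (- 1 - \<beta> / \<alpha>)\<close>.\<close>

lemma stable_law_tail_diff:
  assumes N: "stable_law \<alpha> t N" and N': "stable_law \<alpha> r N'" and A: "A = {c..} \<or> A = {c<..}"
    and "1 \<le> \<alpha>" "0 < r" "r \<le> t" "0 < \<beta>" "\<beta> \<le> 1"
  shows "\<bar>measure N A - measure N' A\<bar>
    \<le> exp 1 * Gamma (\<alpha> + \<beta>) * \<bar>c\<bar> powr \<beta> * (t - r) * r powr (- 1 - \<beta> / \<alpha>)"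
proof -
  interpret N: real_distribution N using N by (simp add: stable_law_def)
  interpret N': real_distribution N' using N' by (simp add: stable_law_def)
  define z where "z = \<bar>c\<bar>"
  have z: "z \<ge> 0" by (simp add: z_def)
  have t: "0 < t" using assms by simp
  let ?F = "\<lambda>u. (iexp (-(u * - z)) - iexp (-(u * z))) / (\<i> * u)"
  \<comment> \<open>Integrability over bounded intervals allows the two inversion integrals to be
    subtracted under one integral sign; the kernel is bounded there by the interval length
    \<open>2 * z\<close>.\<close>
  have int: "complex_interval_lebesgue_integrable lborel a b (\<lambda>u. ?F u * char K u)"
    if K: "real_distribution K" for a b :: real and K
  proof -
    interpret K: real_distribution K by fact
    have [measurable]: "char K \<in> borel_measurable borel" by (rule K.char_measurable)
    have "cmod (?F u * char K u) \<le> 2 * z" if "u \<noteq> 0" for u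
    proof -
      have "cmod (?F u) \<le> 2 * z"
        using Levy_Inversion_aux2[of "-z" z u] z that by simp
      then have "cmod (?F u) * cmod (char K u) \<le> 2 * z * 1"
        using z by (intro mult_mono K.cmod_char_le_1) auto
      then show ?thesis unfolding norm_mult by simp
    qed
    then show ?thesis
      apply (simp add: interval_lebesgue_integrable_def set_integrable_def del: times_divide_eq_left)
      apply (intro integrableI_bounded_set_indicator[where B="2 * z"] conjI impI)
      apply (auto intro!: AE_I [of _ _ "{0}"])
      done
  qed
  let ?L = "complex_of_real ((measure N {- z<..z} - measure N' {- z<..z}) * (2 * pi))"
  have "(\<lambda>n::nat. (CLBINT u=-real n..real n. ?F u * char N u) - (CLBINT u=-real n..real n. ?F u * char N' u))
    \<longlonglongrightarrow> complex_of_real (measure N {- z<..z} * (2 * pi)) - complex_of_real (measure N' {- z<..z} * (2 * pi))"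
    using z assms t
    by (intro tendsto_diff N.Levy_Inversion' N'.Levy_Inversion' stable_law_singleton[OF N] stable_law_singleton[OF N']) auto
  also have "(\<lambda>n::nat. (CLBINT u=-real n..real n. ?F u * char N u) - (CLBINT u=-real n..real n. ?F u * char N' u))
    = (\<lambda>n. CLBINT u=-real n..real n. ?F u * char N u - ?F u * char N' u)"
    using int[of N] int[of N'] N N'
    by (subst interval_lebesgue_integral_diff(2)) (auto simp: stable_law_def)
  also have "(\<lambda>n. CLBINT u=-real n..real n. ?F u * char N u - ?F u * char N' u)
     = (\<lambda>n. CLBINT u=-real n..real n. ?F u * (char N u - char N' u))"
    by (simp add: right_diff_distrib)
  finally have lim: "(\<lambda>n. CLBINT u=-real n..real n. ?F u * (char N u - char N' u)) \<longlonglongrightarrow> ?L"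
    by (simp add: left_diff_distrib)
  define B where "B = 2 * z powr \<beta> * (t - r)"
  have B: "B \<ge> 0" using assms by (simp add: B_def)
  have "norm ?L \<le> 2 * (B * (exp 1 * Gamma (\<alpha> + \<beta>) * r powr (- (\<alpha> + \<beta>) / \<alpha>)))"
  proof (rule norm_limit_symmetric_integral_le[OF lim, where w="\<lambda>u. B * (u powr (\<alpha> + \<beta> - 1) * exp (- (u powr \<alpha>) * r))"])
    fix u :: real assume u: "u \<noteq> 0"
    \<comment> \<open>Symmetry of the interval enters here: the two exponentials combine into a
      sine.\<close>
    have "iexp (-(u * - z)) - iexp (-(u * z)) = 2 * \<i> * complex_of_real (sin (u * z))"
      by (simp add: complex_eq_iff Re_exp Im_exp)
    then have "cmod (?F u) = 2 * \<bar>sin (u * z)\<bar> / \<bar>u\<bar>"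
      by (simp only: norm_divide norm_mult norm_of_real) simp
    also have "\<dots> \<le> 2 * (\<bar>u * z\<bar> powr \<beta>) / \<bar>u\<bar>"
      using assms by (intro divide_right_mono mult_left_mono abs_sin_le_powr) auto
    also have "\<dots> = 2 * z powr \<beta> * \<bar>u\<bar> powr (\<beta> - 1)"
      using u z by (simp add: abs_mult powr_mult powr_diff)
    finally have F: "cmod (?F u) \<le> 2 * z powr \<beta> * \<bar>u\<bar> powr (\<beta> - 1)" .
    define v where "v = \<bar>u\<bar> powr \<alpha>"
    have v: "v \<ge> 0" by (simp add: v_def)
    have "char N u - char N' u = complex_of_real (exp (- v * t) - exp (- v * r))"
      using N N' by (simp add: stable_law_def v_def)
    then have "cmod (char N u - char N' u) = \<bar>exp (- v * t) - exp (- v * r)\<bar>"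
      by (simp only: norm_of_real)
    also have "\<dots> = exp (- v * r) * (1 - exp (- (v * (t - r))))"
    proof -
      have "exp (- v * t) = exp (- v * r) * exp (- (v * (t - r)))"
        by (simp add: exp_add[symmetric] algebra_simps)
      moreover have "exp (- v * t) \<le> exp (- v * r)"
        using assms v by (simp add: mult_left_mono)
      ultimately show ?thesis by (simp add: right_diff_distrib)
    qed
    also have "\<dots> \<le> exp (- v * r) * (v * (t - r))"
      using exp_ge_add_one_self[of "- (v * (t - r))"] by (intro mult_left_mono) auto
    finally have D: "cmod (char N u - char N' u) \<le> exp (- v * r) * (v * (t - r))" .
    have "cmod (?F u * (char N u - char N' u)) \<le> (2 * z powr \<beta> * \<bar>u\<bar> powr (\<beta> - 1)) * (exp (- v * r) * (v * (t - r)))"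
      unfolding norm_mult by (intro mult_mono F D) auto
    also have "\<dots> = B * (\<bar>u\<bar> powr (\<alpha> + \<beta> - 1) * exp (- (\<bar>u\<bar> powr \<alpha>) * r))"
      using u by (simp add: B_def v_def powr_add powr_diff field_simps)
    finally show "cmod (?F u * (char N u - char N' u)) \<le> B * (\<bar>u\<bar> powr (\<alpha> + \<beta> - 1) * exp (- (\<bar>u\<bar> powr \<alpha>) * r))" .
  next
    have "(\<integral>\<^sup>+u\<in>{0<..}. ennreal (B * (u powr (\<alpha> + \<beta> - 1) * exp (- (u powr \<alpha>) * r))) \<partial>lborel)
       = (\<integral>\<^sup>+u. ennreal B * (ennreal (u powr (\<alpha> + \<beta> - 1) * exp (- (u powr \<alpha>) * r)) * indicator {0<..} u) \<partial>lborel)"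
      using B by (intro nn_integral_cong) (auto split: split_indicator simp: ennreal_mult)
    also have "\<dots> = ennreal B * (\<integral>\<^sup>+u\<in>{0<..}. ennreal (u powr (\<alpha> + \<beta> - 1) * exp (- (u powr \<alpha>) * r)) \<partial>lborel)"
      by (intro nn_integral_cmult) auto
    also have "\<dots> \<le> ennreal B * ennreal (exp 1 * Gamma (\<alpha> + \<beta>) * r powr (- (\<alpha> + \<beta>) / \<alpha>))"
      by (intro mult_left_mono nn_integral_powr_exp_le) (use assms in auto)
    finally show "(\<integral>\<^sup>+u\<in>{0<..}. ennreal (B * (u powr (\<alpha> + \<beta> - 1) * exp (- (u powr \<alpha>) * r))) \<partial>lborel)
       \<le> ennreal (B * (exp 1 * Gamma (\<alpha> + \<beta>) * r powr (- (\<alpha> + \<beta>) / \<alpha>)))"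
      using B by (simp add: ennreal_mult')
  qed (use assms B Gamma_real_pos[of "\<alpha> + \<beta>"] in \<open>auto intro!: mult_nonneg_nonneg\<close>)
  moreover have "norm ?L = \<bar>measure N {- z<..z} - measure N' {- z<..z}\<bar> * (2 * pi)"
    by (simp only: norm_of_real abs_mult) simp
  moreover have "\<bar>measure N {- z<..z} - measure N' {- z<..z}\<bar> * 2 \<le> \<bar>measure N {- z<..z} - measure N' {- z<..z}\<bar> * (2 * pi)"
    using pi_gt3 by (intro mult_left_mono) auto
  moreover have "r powr (- (\<alpha> + \<beta>) / \<alpha>) = r powr (- 1 - \<beta> / \<alpha>)"
    using assms by (simp add: add_divide_distrib diff_divide_distrib)
  ultimately have "\<bar>measure N {- z<..z} - measure N' {- z<..z}\<bar>
     \<le> 2 * (exp 1 * Gamma (\<alpha> + \<beta>) * z powr \<beta> * (t - r) * r powr (- 1 - \<beta> / \<alpha>))"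
    by (simp add: B_def mult_ac)
  \<comment> \<open>The terms \<open>1 / 2\<close> of the two tail formulas cancel, which leaves
    half the difference of the interval masses.\<close>
  moreover have "measure N A - measure N' A = - sgn c * (measure N {- z<..z} - measure N' {- z<..z}) / 2"
    unfolding stable_law_tail[OF N \<open>1 \<le> \<alpha>\<close> t A] stable_law_tail[OF N' \<open>1 \<le> \<alpha>\<close> \<open>0 < r\<close> A] z_def
    by (simp add: field_simps)
  then have "\<bar>measure N A - measure N' A\<bar> \<le> \<bar>measure N {- z<..z} - measure N' {- z<..z}\<bar> / 2"
    by (simp add: abs_mult abs_sgn_eq)
  ultimately show ?thesis by (simp add: z_def)
qed

text \<open>The point is that \<open>m\<close> depends on neither \<open>h\<close> nor the law. The
  value \<open>q = 0\<close> is included because the covariance estimate near the diagonal uses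
  it.\<close>

lemma stable_law_moment_bound:
  assumes "0 \<le> q" "q < \<alpha>"
  obtains m where "0 \<le> m"
    "\<And>h N. 0 < h \<Longrightarrow> stable_law \<alpha> h N \<Longrightarrow> (\<integral>\<^sup>+z. ennreal (\<bar>z\<bar> powr q) \<partial>N) \<le> ennreal (m * h powr (q / \<alpha>))"
proof (cases "q = 0")
  \<comment> \<open>The integrand is at most 1: it is 1 away from 0, and
    \<open>0 powr 0 = 0\<close>.\<close>
  case True
  have "(\<integral>\<^sup>+z. ennreal (\<bar>z\<bar> powr q) \<partial>N) \<le> ennreal (1 * h powr (q / \<alpha>))"
    if "0 < h" and N: "stable_law \<alpha> h N" for h N
  proof -
    interpret real_distribution N using N by (simp add: stable_law_def)
    have "(\<integral>\<^sup>+z. ennreal (\<bar>z\<bar> powr q) \<partial>N) \<le> (\<integral>\<^sup>+z. 1 \<partial>N)"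
      using True by (intro nn_integral_mono) (simp add: powr_def)
    also have "\<dots> = 1" using emeasure_space_1 by simp
    finally show ?thesis using True that by simp
  qed
  then show ?thesis using that[of 1] by simp
next
  case False
  define m where "m = (1 / (\<alpha> - q) + 1 / q) / ((1 - cos 1) * 2 powr (- 1 - q))"
  have "0 \<le> m" using assms by (simp add: m_def)
  then show ?thesis
    using that[of m] stable_law_moment[of \<alpha> _ _ q] assms False by (simp add: m_def)
qed

section \<open>Increments of the process\<close>

text \<open>\<^const>\<open>prob_space.indep_var\<close> forces both variables to have the same value type,
  hence this heterogeneous version.\<close>
definition product_law :: "'w measure \<Rightarrow> 'a measure \<Rightarrow> ('w \<Rightarrow> 'a) \<Rightarrow> 'b measure \<Rightarrow> ('w \<Rightarrow> 'b) \<Rightarrow> bool" where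
  "product_law M S U T V \<longleftrightarrow> U \<in> measurable M S \<and> V \<in> measurable M T \<and>
     distr M S U \<Otimes>\<^sub>M distr M T V = distr M (S \<Otimes>\<^sub>M T) (\<lambda>\<omega>. (U \<omega>, V \<omega>))"

section \<open>Iterated integration for independent pairs\<close>

context prob_space
begin

lemma product_law_compose:
  assumes "product_law M S U T V" and f[measurable]: "f \<in> measurable S S'" and g[measurable]: "g \<in> measurable T T'"
  shows "product_law M S' (\<lambda>\<omega>. f (U \<omega>)) T' (\<lambda>\<omega>. g (V \<omega>))"
proof -
  have [measurable]: "U \<in> measurable M S" "V \<in> measurable M T"
    and eq: "distr M S U \<Otimes>\<^sub>M distr M T V = distr M (S \<Otimes>\<^sub>M T) (\<lambda>\<omega>. (U \<omega>, V \<omega>))"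
    using assms(1) by (auto simp: product_law_def)
  interpret V: prob_space "distr M T' (\<lambda>\<omega>. g (V \<omega>))" by (rule prob_space_distr) measurable
  have 1: "distr M S' (\<lambda>\<omega>. f (U \<omega>)) = distr (distr M S U) S' f"
    "distr M T' (\<lambda>\<omega>. g (V \<omega>)) = distr (distr M T V) T' g"
    by (subst distr_distr; simp add: comp_def)+
  have "distr M S' (\<lambda>\<omega>. f (U \<omega>)) \<Otimes>\<^sub>M distr M T' (\<lambda>\<omega>. g (V \<omega>))
    = distr (distr M S U \<Otimes>\<^sub>M distr M T V) (S' \<Otimes>\<^sub>M T') (\<lambda>(x, y). (f x, g y))"
    unfolding 1 by (rule pair_measure_distr) (auto simp: V.sigma_finite_measure_axioms simp flip: 1)
  also have "\<dots> = distr M (S' \<Otimes>\<^sub>M T') (\<lambda>\<omega>. (f (U \<omega>), g (V \<omega>)))"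
    unfolding eq by (subst distr_distr) (auto simp: comp_def)
  finally show ?thesis by (simp add: product_law_def)
qed

text \<open>The inner integral runs over the first variable, so that a bound on the mass of
  intervals under its law can be applied with the second variable fixed.\<close>

lemma nn_integral_product_law:
  assumes ind: "product_law M S U T V" and f[measurable]: "f \<in> borel_measurable (S \<Otimes>\<^sub>M T)"
  shows "(\<integral>\<^sup>+\<omega>. f (U \<omega>, V \<omega>) \<partial>M) = (\<integral>\<^sup>+v. (\<integral>\<^sup>+u. f (u, v) \<partial>distr M S U) \<partial>distr M T V)"
proof -
  have [measurable]: "U \<in> measurable M S" "V \<in> measurable M T"
    and eq: "distr M S U \<Otimes>\<^sub>M distr M T V = distr M (S \<Otimes>\<^sub>M T) (\<lambda>\<omega>. (U \<omega>, V \<omega>))"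
    using ind by (auto simp: product_law_def)
  interpret U: prob_space "distr M S U" by (rule prob_space_distr) measurable
  interpret V: prob_space "distr M T V" by (rule prob_space_distr) measurable
  interpret P: pair_sigma_finite "distr M S U" "distr M T V" ..
  have "(\<integral>\<^sup>+\<omega>. f (U \<omega>, V \<omega>) \<partial>M) = integral\<^sup>N (distr M S U \<Otimes>\<^sub>M distr M T V) f"
    unfolding eq by (subst nn_integral_distr) auto
  also have "\<dots> = (\<integral>\<^sup>+v. (\<integral>\<^sup>+u. f (u, v) \<partial>distr M S U) \<partial>distr M T V)"
    by (rule P.nn_integral_snd[symmetric]) simp
  finally show ?thesis .
qed

text \<open>This is conditioning in integrated form: with the first variable frozen, the second is
  averaged out. Boundedness of \<open>f\<close> gives integrability on the product.\<close>

lemma integral_product_law: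
  fixes f :: "'u \<times> 'v \<Rightarrow> real"
  assumes ind: "product_law M S U T V" and f[measurable]: "f \<in> borel_measurable (S \<Otimes>\<^sub>M T)"
    and B: "\<And>x. \<bar>f x\<bar> \<le> B"
  shows "(\<integral>\<omega>. f (U \<omega>, V \<omega>) \<partial>M) = (\<integral>\<omega>. (\<integral>v. f (U \<omega>, v) \<partial>distr M T V) \<partial>M)"
proof -
  have [measurable]: "U \<in> measurable M S" "V \<in> measurable M T"
    and eq: "distr M S U \<Otimes>\<^sub>M distr M T V = distr M (S \<Otimes>\<^sub>M T) (\<lambda>\<omega>. (U \<omega>, V \<omega>))"
    using ind by (auto simp: product_law_def)
  interpret U: prob_space "distr M S U" by (rule prob_space_distr) measurable
  interpret V: prob_space "distr M T V" by (rule prob_space_distr) measurable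
  interpret P: pair_prob_space "distr M S U" "distr M T V" ..
  have "(\<integral>\<omega>. f (U \<omega>, V \<omega>) \<partial>M) = integral\<^sup>L (distr M S U \<Otimes>\<^sub>M distr M T V) f"
    unfolding eq by (subst integral_distr) auto
  also have "\<dots> = (\<integral>u. (\<integral>v. f (u, v) \<partial>distr M T V) \<partial>distr M S U)"
    using B by (intro P.integral_fst'[symmetric] P.P.integrable_const_bound[where B=B]) auto
  also have "\<dots> = (\<integral>\<omega>. (\<integral>v. f (U \<omega>, v) \<partial>distr M T V) \<partial>M)"
    by (intro integral_distr) measurable
  finally show ?thesis .
qed

end

section \<open>The process and its independent increments\<close>

locale sas_process =
  fixes M :: "'w measure" and \<alpha> :: real and X :: "real \<Rightarrow> 'w \<Rightarrow> real"
  assumes \<alpha>: "1 < \<alpha>" "\<alpha> \<le> 2" and sas: "sas_levy M \<alpha> X"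
begin

sublocale prob_space M
  using sas by (simp add: sas_levy_def)

lemma measurable_X: "0 \<le> t \<Longrightarrow> X t \<in> borel_measurable M"
  using sas by (simp add: sas_levy_def)

lemma X_0: "\<omega> \<in> space M \<Longrightarrow> X 0 \<omega> = 0"
  using sas by (simp add: sas_levy_def)

lemma stable_law_increment:
  assumes "0 \<le> s" "s \<le> t"
  shows "stable_law \<alpha> (t - s) (distr M borel (\<lambda>\<omega>. X t \<omega> - X s \<omega>))"
  using sas assms unfolding stable_law_def sas_levy_def
  by (auto intro!: real_distribution_distr borel_measurable_diff)

text \<open>Both past positions are functions of the increments over \<open>[0, u]\<close> and
  \<open>[u, s]\<close>, which are independent of the later one. They are written as increments from
  time 0 because \<open>X 0\<close> is known to vanish only on \<open>space M\<close>.\<close>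

lemma indep_past_increment:
  assumes "0 \<le> u" "u < s" "s < t"
  shows "product_law M (borel \<Otimes>\<^sub>M borel) (\<lambda>\<omega>. (X u \<omega> - X 0 \<omega>, X s \<omega> - X 0 \<omega>)) borel (\<lambda>\<omega>. X t \<omega> - X s \<omega>)"
proof -
  have *: "product_law M (borel \<Otimes>\<^sub>M borel) (\<lambda>\<omega>. (X u \<omega> - X 0 \<omega>, X s \<omega> - X 0 \<omega>)) borel (\<lambda>\<omega>. X t \<omega> - X s \<omega>)"
    if "0 < u" "u < s" for u
  proof -
    \<comment> \<open>The values from index 3 on start at \<open>t\<close> and merely continue the
      sequence in a strictly increasing way; only the first three increments are used.\<close>
    define ts :: "nat \<Rightarrow> real" where
      "ts i = (if i = 0 then 0 else if i = 1 then u else if i = 2 then s else t + (real i - 3))" for i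
    let ?Y = "\<lambda>i \<omega>. X (ts (Suc i)) \<omega> - X (ts i) \<omega>"
    have mono: "strict_mono ts"
      unfolding strict_mono_Suc_iff using that assms by (auto simp: ts_def)
    have "0 \<le> ts 0" by (simp add: ts_def)
    with mono have "indep_vars (\<lambda>_. borel) ?Y {..<3::nat}"
      using sas unfolding sas_levy_def by blast
    then have "indep_var (PiM {0,1} (\<lambda>_. borel)) (\<lambda>\<omega>. restrict (\<lambda>i. ?Y i \<omega>) {0,1})
      (PiM {2} (\<lambda>_. borel)) (\<lambda>\<omega>. restrict (\<lambda>i. ?Y i \<omega>) {2::nat})"
      by (rule indep_var_restrict) auto
    then have "product_law M (PiM {0,1} (\<lambda>_. borel)) (\<lambda>\<omega>. restrict (\<lambda>i. ?Y i \<omega>) {0,1})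
      (PiM {2} (\<lambda>_. borel)) (\<lambda>\<omega>. restrict (\<lambda>i. ?Y i \<omega>) {2::nat})"
      unfolding indep_var_distribution_eq product_law_def by simp
    \<comment> \<open>The sum of the first two increments telescopes to
      \<open>X s - X 0\<close>.\<close>
    from product_law_compose[OF this, of "\<lambda>f. (f 0, f 0 + f 1)" "borel \<Otimes>\<^sub>M borel" "\<lambda>f. f 2" borel]
    show ?thesis by (simp add: ts_def)
  qed
  show ?thesis
  proof (cases "u = 0")
    case True
    \<comment> \<open>For \<open>u = 0\<close> the times would not be strictly increasing. The
      midpoint \<open>s / 2\<close> stands in for \<open>u\<close>, and its position is then
      replaced by 0.\<close>
    have "0 < s / 2" "s / 2 < s" using assms True by auto
    then have "product_law M (borel \<Otimes>\<^sub>M borel) (\<lambda>\<omega>. (\<lambda>p. (0, snd p)) (X (s / 2) \<omega> - X 0 \<omega>, X s \<omega> - X 0 \<omega>))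
        borel (\<lambda>\<omega>. (\<lambda>x. x) (X t \<omega> - X s \<omega>))"
      by (rule product_law_compose[OF *]) measurable
    then show ?thesis unfolding True by (simp only: snd_conv diff_self)
  next
    case False
    show ?thesis by (rule *) (use assms False in auto)
  qed
qed

lemma indep_present_increment:
  assumes "0 < s" "s < t"
  shows "product_law M borel (\<lambda>\<omega>. X s \<omega> - X 0 \<omega>) borel (\<lambda>\<omega>. X t \<omega> - X s \<omega>)"
proof -
  have "product_law M borel (\<lambda>\<omega>. snd (X 0 \<omega> - X 0 \<omega>, X s \<omega> - X 0 \<omega>)) borel (\<lambda>\<omega>. (\<lambda>x. x) (X t \<omega> - X s \<omega>))"
    by (rule product_law_compose[OF indep_past_increment[OF order_refl assms]]) measurable
  then show ?thesis by (simp only: snd_conv)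
qed

end

section \<open>Crossings of the endpoint of a ray\<close>

text \<open>Both forms occur, since the interval \<open>[a, b]\<close> is the difference of
  \<open>{a..}\<close> and \<open>{b<..}\<close>.\<close>

definition ray :: "real \<Rightarrow> real set \<Rightarrow> bool" where
  "ray c A \<longleftrightarrow> A = {c..} \<or> A = {c<..}"

lemma ray_borel [measurable_dest]: "ray c A \<Longrightarrow> A \<in> sets borel"
  by (auto simp: ray_def)

text \<open>If the two indicators differ, then \<open>c\<close> lies between \<open>x\<close> and
  \<open>y\<close>, so neither is farther from \<open>c\<close> than \<open>|y - x|\<close>. The
  estimate at \<open>x\<close> feeds the density bound, the one at \<open>y\<close> the comparison
  of tails.\<close>

lemma ray_crossing:
  assumes "ray c A"
  shows "\<bar>indicator A y - indicator A x :: real\<bar> \<le> indicator {c - \<bar>y - x\<bar>..c + \<bar>y - x\<bar>} x"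
    and "\<bar>indicator A y - indicator A x :: real\<bar> \<le> indicator {c - \<bar>y - x\<bar>..c + \<bar>y - x\<bar>} y"
  using assms by (auto simp: ray_def split: split_indicator)

context sas_process
begin

text \<open>Given the past, \<open>X t\<close> is \<open>X s\<close> plus an independent increment,
  so the indicator may be replaced by the probability that the increment carries \<open>X s\<close>
  into the ray.\<close>

lemma integral_past_ray:
  fixes \<phi> :: "real \<times> real \<Rightarrow> real"
  assumes A: "ray c A" and "0 \<le> u" "u < s" "s < t"
    and \<phi>[measurable]: "\<phi> \<in> borel_measurable (borel \<Otimes>\<^sub>M borel)" and B: "\<And>x. \<bar>\<phi> x\<bar> \<le> 1"
  shows "(\<integral>\<omega>. \<phi> (X u \<omega>, X s \<omega>) * indicator A (X t \<omega>) \<partial>M)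
    = (\<integral>\<omega>. \<phi> (X u \<omega>, X s \<omega>) * measure (distr M borel (\<lambda>\<omega>. X t \<omega> - X s \<omega>)) {v. X s \<omega> + v \<in> A} \<partial>M)"
proof -
  note [measurable] = ray_borel[OF A]
  let ?L = "distr M borel (\<lambda>\<omega>. X t \<omega> - X s \<omega>)"
  let ?f = "\<lambda>(p, v). \<phi> p * indicator A (snd p + v)"
  have m[measurable]: "X u \<in> borel_measurable M" "X s \<in> borel_measurable M" "X t \<in> borel_measurable M"
    using assms by (auto intro: measurable_X)
  interpret L: prob_space ?L by (intro prob_space_distr) measurable
  have "(\<integral>\<omega>. \<phi> (X u \<omega>, X s \<omega>) * indicator A (X t \<omega>) \<partial>M)
     = (\<integral>\<omega>. ?f ((X u \<omega> - X 0 \<omega>, X s \<omega> - X 0 \<omega>), X t \<omega> - X s \<omega>) \<partial>M)"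
    by (intro Bochner_Integration.integral_cong) (auto simp: X_0)
  also have "\<dots> = (\<integral>\<omega>. (\<integral>v. ?f ((X u \<omega> - X 0 \<omega>, X s \<omega> - X 0 \<omega>), v) \<partial>?L) \<partial>M)"
    using B assms by (intro integral_product_law[where B=1, OF indep_past_increment]) (auto split: split_indicator)
  also have "\<dots> = (\<integral>\<omega>. \<phi> (X u \<omega>, X s \<omega>) * measure ?L {v. X s \<omega> + v \<in> A} \<partial>M)"
  proof (intro Bochner_Integration.integral_cong refl)
    fix \<omega> assume "\<omega> \<in> space M"
    then have "(\<integral>v. ?f ((X u \<omega> - X 0 \<omega>, X s \<omega> - X 0 \<omega>), v) \<partial>?L)
      = (\<integral>v. \<phi> (X u \<omega>, X s \<omega>) * indicator {v. X s \<omega> + v \<in> A} v \<partial>?L)"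
      by (intro Bochner_Integration.integral_cong) (auto simp: X_0 indicator_def)
    also have "\<dots> = \<phi> (X u \<omega>, X s \<omega>) * measure ?L {v. X s \<omega> + v \<in> A}"
      by simp
    finally show "(\<integral>v. ?f ((X u \<omega> - X 0 \<omega>, X s \<omega> - X 0 \<omega>), v) \<partial>?L)
      = \<phi> (X u \<omega>, X s \<omega>) * measure ?L {v. X s \<omega> + v \<in> A}" .
  qed
  finally show ?thesis .
qed

text \<open>With the increment \<open>z\<close> fixed, a crossing forces \<open>X u\<close> into an
  interval of length \<open>2 * |z|\<close> around \<open>c\<close>. Since \<open>X u\<close> is
  independent of the increment, this has probability at most
  \<open>2 * |z| * exp 1 * u powr (- 1 / \<alpha>)\<close>, which raises the moment from order
  \<open>q\<close> to order \<open>1 + q\<close>.\<close>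

lemma crossing_moment:
  assumes A: "ray c A" and "0 < u" "u < s"
  shows "(\<integral>\<^sup>+\<omega>. ennreal (\<bar>indicator A (X s \<omega>) - indicator A (X u \<omega>)\<bar> * \<bar>X s \<omega> - X u \<omega>\<bar> powr q) \<partial>M)
    \<le> ennreal (2 * exp 1 * u powr (- 1 / \<alpha>)) *
        (\<integral>\<^sup>+z. ennreal (\<bar>z\<bar> powr (1 + q)) \<partial>distr M borel (\<lambda>\<omega>. X s \<omega> - X u \<omega>))"
proof -
  note [measurable] = ray_borel[OF A]
  have [measurable]: "X u \<in> borel_measurable M" "X s \<in> borel_measurable M" "X 0 \<in> borel_measurable M"
    using assms by (auto intro: measurable_X)
  let ?L = "distr M borel (\<lambda>\<omega>. X s \<omega> - X u \<omega>)"
  let ?K = "distr M borel (\<lambda>\<omega>. X u \<omega> - X 0 \<omega>)"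
  let ?F = "\<lambda>(x, z). ennreal (\<bar>z\<bar> powr q) * indicator {p. c - \<bar>snd p\<bar> \<le> fst p \<and> fst p \<le> c + \<bar>snd p\<bar>} (x :: real, z :: real)"
  have K: "stable_law \<alpha> u ?K" using stable_law_increment[of 0 u] assms by simp
  interpret K: real_distribution ?K using K by (simp add: stable_law_def)
  have "(\<integral>\<^sup>+\<omega>. ennreal (\<bar>indicator A (X s \<omega>) - indicator A (X u \<omega>)\<bar> * \<bar>X s \<omega> - X u \<omega>\<bar> powr q) \<partial>M)
    \<le> (\<integral>\<^sup>+\<omega>. ?F (X u \<omega> - X 0 \<omega>, X s \<omega> - X u \<omega>) \<partial>M)"
  proof (intro nn_integral_mono)
    fix \<omega> assume \<omega>: "\<omega> \<in> space M"
    let ?i = "indicator {c - \<bar>X s \<omega> - X u \<omega>\<bar>..c + \<bar>X s \<omega> - X u \<omega>\<bar>} (X u \<omega>)"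
    have "ennreal (\<bar>indicator A (X s \<omega>) - indicator A (X u \<omega>)\<bar> * \<bar>X s \<omega> - X u \<omega>\<bar> powr q)
       \<le> ennreal (?i * \<bar>X s \<omega> - X u \<omega>\<bar> powr q)"
      by (intro ennreal_leI mult_right_mono ray_crossing[OF A]) auto
    also have "\<dots> = ?F (X u \<omega> - X 0 \<omega>, X s \<omega> - X u \<omega>)"
      using \<omega> by (auto simp: X_0 split: split_indicator)
    finally show "ennreal (\<bar>indicator A (X s \<omega>) - indicator A (X u \<omega>)\<bar> * \<bar>X s \<omega> - X u \<omega>\<bar> powr q)
      \<le> ?F (X u \<omega> - X 0 \<omega>, X s \<omega> - X u \<omega>)" .
  qed
  also have "\<dots> = (\<integral>\<^sup>+z. (\<integral>\<^sup>+x. ?F (x, z) \<partial>?K) \<partial>?L)"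
    using assms by (intro nn_integral_product_law[OF indep_present_increment]) auto
  also have "\<dots> \<le> (\<integral>\<^sup>+z. ennreal (2 * exp 1 * u powr (- 1 / \<alpha>)) * ennreal (\<bar>z\<bar> powr (1 + q)) \<partial>?L)"
  proof (intro nn_integral_mono)
    fix z
    have "(\<integral>\<^sup>+x. ?F (x, z) \<partial>?K) = (\<integral>\<^sup>+x. ennreal (\<bar>z\<bar> powr q) * indicator {c - \<bar>z\<bar>..c + \<bar>z\<bar>} x \<partial>?K)"
      by (intro nn_integral_cong) (auto split: split_indicator)
    also have "\<dots> = ennreal (\<bar>z\<bar> powr q) * emeasure ?K {c - \<bar>z\<bar>..c + \<bar>z\<bar>}"
      by (intro nn_integral_cmult_indicator) simp
    also have "\<dots> = ennreal (\<bar>z\<bar> powr q * measure ?K {c - \<bar>z\<bar>..c + \<bar>z\<bar>})"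
      by (simp add: K.emeasure_eq_measure ennreal_mult)
    also have "\<dots> \<le> ennreal (\<bar>z\<bar> powr q * (exp 1 * u powr (- 1 / \<alpha>) * ((c + \<bar>z\<bar>) - (c - \<bar>z\<bar>))))"
      using \<alpha> assms by (intro ennreal_leI mult_left_mono stable_law_interval_le[OF K]) auto
    also have "\<bar>z\<bar> powr q * (exp 1 * u powr (- 1 / \<alpha>) * ((c + \<bar>z\<bar>) - (c - \<bar>z\<bar>)))
      = (2 * exp 1 * u powr (- 1 / \<alpha>)) * \<bar>z\<bar> powr (1 + q)"
      by (cases "z = 0") (auto simp: powr_add)
    finally show "(\<integral>\<^sup>+x. ?F (x, z) \<partial>?K) \<le> ennreal (2 * exp 1 * u powr (- 1 / \<alpha>)) * ennreal (\<bar>z\<bar> powr (1 + q))"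
      by (simp add: ennreal_mult)
  qed
  also have "\<dots> = ennreal (2 * exp 1 * u powr (- 1 / \<alpha>)) * (\<integral>\<^sup>+z. ennreal (\<bar>z\<bar> powr (1 + q)) \<partial>?L)"
    by (intro nn_integral_cmult) auto
  finally show ?thesis .
qed

text \<open>In the first cell, where \<open>u = 0\<close>, the position \<open>X u\<close> has no
  density, and the plain moment of the increment is used together with
  \<open>\<Delta> / s \<ge> 1\<close>. In later cells \<open>u\<close> and \<open>s\<close> are
  comparable and the crossing estimate applies.\<close>

lemma crossing_moment_bound:
  assumes q: "0 \<le> q" "1 + q < \<alpha>"
  obtains C where "0 \<le> C"
    "\<And>c A (u::real) (s::real) \<Delta>. ray c A \<Longrightarrow> 0 < \<Delta> \<Longrightarrow> u = 0 \<or> \<Delta> \<le> u \<Longrightarrow> u \<le> s \<Longrightarrow> s < u + \<Delta> \<Longrightarrow> 0 < s \<Longrightarrow>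
      (\<integral>\<^sup>+\<omega>. ennreal (\<bar>indicator A (X s \<omega>) - indicator A (X u \<omega>)\<bar> * \<bar>X s \<omega> - X u \<omega>\<bar> powr q) \<partial>M)
      \<le> ennreal (C * (\<Delta> / s) powr (1 / \<alpha>) * \<Delta> powr (q / \<alpha>))"
proof -
  obtain m0 where m0: "0 \<le> m0" "\<And>h N. 0 < h \<Longrightarrow> stable_law \<alpha> h N \<Longrightarrow>
      (\<integral>\<^sup>+z. ennreal (\<bar>z\<bar> powr q) \<partial>N) \<le> ennreal (m0 * h powr (q / \<alpha>))"
    using stable_law_moment_bound[of q \<alpha>] q by auto
  obtain m1 where m1: "0 \<le> m1" "\<And>h N. 0 < h \<Longrightarrow> stable_law \<alpha> h N \<Longrightarrow>
      (\<integral>\<^sup>+z. ennreal (\<bar>z\<bar> powr (1 + q)) \<partial>N) \<le> ennreal (m1 * h powr ((1 + q) / \<alpha>))"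
    using stable_law_moment_bound[of "1 + q" \<alpha>] q by auto
  define k where "k = 2 * exp 1 * 2 powr (1 / \<alpha>) * m1"
  have k: "0 \<le> k" using m1 by (simp add: k_def)
  have \<alpha>0: "0 < \<alpha>" using \<alpha> by simp
  show thesis
  proof (rule that[of "m0 + k"])
    show "0 \<le> m0 + k" using m0 k by simp
    fix c A and u s \<Delta> :: real
    assume A: "ray c A" and \<Delta>: "0 < \<Delta>" and u: "u = 0 \<or> \<Delta> \<le> u" "u \<le> s" "s < u + \<Delta>" and s: "0 < s"
    let ?I = "\<integral>\<^sup>+\<omega>. ennreal (\<bar>indicator A (X s \<omega>) - indicator A (X u \<omega>)\<bar> * \<bar>X s \<omega> - X u \<omega>\<bar> powr q) \<partial>M"
    let ?L = "distr M borel (\<lambda>\<omega>. X s \<omega> - X u \<omega>)"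
    have u0: "0 \<le> u" using u \<Delta> by auto
    have s': "0 \<le> s" using s by simp
    note [measurable] = measurable_X[OF u0] measurable_X[OF s']
    show "?I \<le> ennreal ((m0 + k) * (\<Delta> / s) powr (1 / \<alpha>) * \<Delta> powr (q / \<alpha>))"
    proof (cases "u = s")
      case False
      then have us: "u < s" using u by simp
      have L: "stable_law \<alpha> (s - u) ?L" using stable_law_increment[OF u0 u(2)] .
      show ?thesis
      proof (cases "u = 0")
        case True
        have "?I \<le> (\<integral>\<^sup>+\<omega>. ennreal (\<bar>X s \<omega> - X u \<omega>\<bar> powr q) \<partial>M)"
          by (intro nn_integral_mono ennreal_leI) (auto split: split_indicator)
        also have "\<dots> = (\<integral>\<^sup>+z. ennreal (\<bar>z\<bar> powr q) \<partial>?L)"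
          by (subst nn_integral_distr) auto
        also have "\<dots> \<le> ennreal (m0 * (s - u) powr (q / \<alpha>))"
          using us by (intro m0 L) auto
        also have "\<dots> \<le> ennreal ((m0 + k) * (\<Delta> / s) powr (1 / \<alpha>) * \<Delta> powr (q / \<alpha>))"
        proof (intro ennreal_leI mult_mono)
          have "1 \<le> (\<Delta> / s) powr (1 / \<alpha>)"
            using True u s \<alpha>0 by (intro ge_one_powr_ge_zero) (auto simp: field_simps)
          then have "(m0 + k) * 1 \<le> (m0 + k) * (\<Delta> / s) powr (1 / \<alpha>)"
            using m0 k by (intro mult_left_mono) auto
          then show "m0 \<le> (m0 + k) * (\<Delta> / s) powr (1 / \<alpha>)" using k by simp
          show "(s - u) powr (q / \<alpha>) \<le> \<Delta> powr (q / \<alpha>)"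
            using us u q \<alpha>0 by (intro powr_mono2) auto
        qed (use m0 k in auto)
        finally show ?thesis .
      next
        case False
        then have u': "0 < u" "\<Delta> \<le> u" using u u0 by auto
        have "?I \<le> ennreal (2 * exp 1 * u powr (- 1 / \<alpha>)) * (\<integral>\<^sup>+z. ennreal (\<bar>z\<bar> powr (1 + q)) \<partial>?L)"
          by (rule crossing_moment[OF A u'(1) us])
        also have "\<dots> \<le> ennreal (2 * exp 1 * u powr (- 1 / \<alpha>)) * ennreal (m1 * (s - u) powr ((1 + q) / \<alpha>))"
          using us by (intro mult_left_mono m1 L) auto
        also have "\<dots> = ennreal (2 * exp 1 * u powr (- 1 / \<alpha>) * (m1 * (s - u) powr ((1 + q) / \<alpha>)))"
          using m1 by (simp add: ennreal_mult)
        also have "\<dots> \<le> ennreal (2 * exp 1 * (s / 2) powr (- 1 / \<alpha>) * (m1 * \<Delta> powr ((1 + q) / \<alpha>)))"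
        proof (intro ennreal_leI mult_mono)
          \<comment> \<open>From \<open>\<Delta> \<le> u\<close> and \<open>s < u + \<Delta>\<close>
            follows \<open>s / 2 \<le> u\<close>; this costs the factor
            \<open>2 powr (1 / \<alpha>)\<close> in \<open>k\<close>.\<close>
          show "u powr (- 1 / \<alpha>) \<le> (s / 2) powr (- 1 / \<alpha>)"
            using u u' s \<alpha>0 by (intro powr_mono2') auto
          show "(s - u) powr ((1 + q) / \<alpha>) \<le> \<Delta> powr ((1 + q) / \<alpha>)"
            using us u q \<alpha>0 by (intro powr_mono2) auto
        qed (use m1 in auto)
        also have "2 * exp 1 * (s / 2) powr (- 1 / \<alpha>) * (m1 * \<Delta> powr ((1 + q) / \<alpha>))
          = k * (\<Delta> / s) powr (1 / \<alpha>) * \<Delta> powr (q / \<alpha>)"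
        proof -
          have "(s / 2) powr (- 1 / \<alpha>) = 2 powr (1 / \<alpha>) / s powr (1 / \<alpha>)"
            using s powr_minus_divide[of "s / 2" "1 / \<alpha>"] by (simp add: powr_divide)
          then show ?thesis
            using s \<Delta> by (simp add: k_def powr_divide add_divide_distrib powr_add)
        qed
        also have "ennreal (k * (\<Delta> / s) powr (1 / \<alpha>) * \<Delta> powr (q / \<alpha>))
          \<le> ennreal ((m0 + k) * (\<Delta> / s) powr (1 / \<alpha>) * \<Delta> powr (q / \<alpha>))"
          using m0 by (intro ennreal_leI mult_right_mono) auto
        finally show ?thesis .
      qed
    qed simp
  qed
qed

end

section \<open>Covariances of two crossings\<close>

text \<open>The default value 0 of the integral settles the case in which \<open>f\<close> is not
  integrable.\<close>

lemma ennreal_abs_integral_le: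
  fixes f :: "'a \<Rightarrow> real"
  shows "ennreal \<bar>\<integral>x. f x \<partial>M\<bar> \<le> (\<integral>\<^sup>+x. ennreal \<bar>f x\<bar> \<partial>M)"
proof (cases "integrable M f")
  case True
  then show ?thesis using integral_norm_bound_ennreal[of M f] by simp
qed (simp add: not_integrable_integral_eq)

context sas_process
begin

text \<open>Conditioning on the past of \<open>s\<close> turns the second factor into a difference
  of two tails at \<open>c - X s\<close>. This is at most a constant times
  \<open>|c - X s| powr \<beta>\<close>, and on a first crossing \<open>|c - X s|\<close> is at most
  \<open>|X s - X u|\<close>, which leads to the moment bounded by \<open>B\<close>.\<close>

lemma integral_past_ray_diff:
  assumes A: "ray c A" and "0 \<le> u" "u \<le> s" "s < r" "r \<le> t" "0 < \<beta>" "\<beta> \<le> 1" "0 \<le> B"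
    and B: "(\<integral>\<^sup>+\<omega>. ennreal (\<bar>indicator A (X s \<omega>) - indicator A (X u \<omega>)\<bar> * \<bar>X s \<omega> - X u \<omega>\<bar> powr \<beta>) \<partial>M) \<le> ennreal B"
  shows "\<bar>\<integral>\<omega>. (indicator A (X s \<omega>) - indicator A (X u \<omega>)) * (indicator A (X t \<omega>) - indicator A (X r \<omega>)) \<partial>M\<bar>
    \<le> exp 1 * Gamma (\<alpha> + \<beta>) * (t - r) * (r - s) powr (- 1 - \<beta> / \<alpha>) * B"
proof (cases "u = s")
  \<comment> \<open>Here the first factor vanishes; the independence statement is only available for
    \<open>u < s\<close>.\<close>
  case True
  then show ?thesis using assms Gamma_real_pos[of "\<alpha> + \<beta>"] \<alpha> by simp
next
  case False
  then have us: "u < s" using assms by simp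
  note A_borel[measurable] = ray_borel[OF A]
  have [measurable]: "X u \<in> borel_measurable M" "X s \<in> borel_measurable M" "X r \<in> borel_measurable M" "X t \<in> borel_measurable M"
    using assms by (auto intro: measurable_X)
  define \<phi> :: "real \<times> real \<Rightarrow> real" where "\<phi> = (\<lambda>(x, y). indicator A y - indicator A x)"
  have \<phi>[measurable]: "\<phi> \<in> borel_measurable (borel \<Otimes>\<^sub>M borel)" unfolding \<phi>_def by measurable
  have \<phi>1: "\<bar>\<phi> x\<bar> \<le> 1" for x by (auto simp: \<phi>_def split: prod.split split_indicator)
  define L where "L t = distr M borel (\<lambda>\<omega>. X t \<omega> - X s \<omega>)" for t
  \<comment> \<open>This is the probability of finding the process in \<open>A\<close> at time
    \<open>t\<close> when it is at \<open>x\<close> at time \<open>s\<close>.\<close>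
  define m where "m t x = measure (L t) {v. x + v \<in> A}" for t x
  have m_props: "m t \<in> borel_measurable borel \<and> (\<forall>x. 0 \<le> m t x \<and> m t x \<le> 1)" if "s < t" for t
  proof -
    have [measurable]: "X t \<in> borel_measurable M" using that assms by (auto intro: measurable_X)
    interpret L: real_distribution "L t"
      unfolding L_def by (intro real_distribution_distr) measurable
    \<comment> \<open>As an integral with parameter \<open>x\<close>, the probability is seen to be
      measurable in \<open>x\<close>.\<close>
    have "m t x = (\<integral>v. indicator A (x + v) \<partial>L t)" for x
    proof -
      have "(\<integral>v. indicator A (x + v) \<partial>L t) = (\<integral>v. indicator {v. x + v \<in> A} v \<partial>L t :: real)"
        by (intro Bochner_Integration.integral_cong) (auto simp: indicator_def)
      then show ?thesis by (simp add: m_def)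
    qed
    then have mt: "m t = (\<lambda>x. \<integral>v. indicator A (x + v) \<partial>L t)" by auto
    have "m t \<in> borel_measurable borel" unfolding mt by measurable
    moreover have "0 \<le> m t x \<and> m t x \<le> 1" for x by (simp add: m_def)
    ultimately show ?thesis by blast
  qed
  have st: "s < t" using assms by simp
  note [measurable] = m_props[OF st, THEN conjunct1] m_props[OF \<open>s < r\<close>, THEN conjunct1]
  have int: "integrable M (\<lambda>\<omega>. \<phi> (X u \<omega>, X s \<omega>) * f \<omega>)"
    if [measurable]: "f \<in> borel_measurable M" and "\<And>\<omega>. 0 \<le> f \<omega> \<and> f \<omega> \<le> 1" for f
  proof (rule integrable_const_bound[where B=1])
    show "AE \<omega> in M. norm (\<phi> (X u \<omega>, X s \<omega>) * f \<omega>) \<le> 1"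
      using \<phi>1 that(2) by (intro AE_I2) (simp add: abs_mult mult_le_one)
  qed measurable
  have eq: "(\<integral>\<omega>. \<phi> (X u \<omega>, X s \<omega>) * indicator A (X t \<omega>) \<partial>M) = (\<integral>\<omega>. \<phi> (X u \<omega>, X s \<omega>) * m t (X s \<omega>) \<partial>M)"
    if "s < t" for t
    unfolding m_def L_def by (rule integral_past_ray[OF A _ us that \<phi> \<phi>1]) (use assms in auto)
  have "(\<integral>\<omega>. (indicator A (X s \<omega>) - indicator A (X u \<omega>)) * (indicator A (X t \<omega>) - indicator A (X r \<omega>)) \<partial>M)
    = (\<integral>\<omega>. \<phi> (X u \<omega>, X s \<omega>) * indicator A (X t \<omega>) - \<phi> (X u \<omega>, X s \<omega>) * indicator A (X r \<omega>) \<partial>M)"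
    by (simp add: \<phi>_def right_diff_distrib)
  also have "\<dots> = (\<integral>\<omega>. \<phi> (X u \<omega>, X s \<omega>) * indicator A (X t \<omega>) \<partial>M) - (\<integral>\<omega>. \<phi> (X u \<omega>, X s \<omega>) * indicator A (X r \<omega>) \<partial>M)"
    by (intro Bochner_Integration.integral_diff int) (auto split: split_indicator)
  also have "\<dots> = (\<integral>\<omega>. \<phi> (X u \<omega>, X s \<omega>) * m t (X s \<omega>) \<partial>M) - (\<integral>\<omega>. \<phi> (X u \<omega>, X s \<omega>) * m r (X s \<omega>) \<partial>M)"
    by (simp only: eq[OF st] eq[OF \<open>s < r\<close>])
  also have "\<dots> = (\<integral>\<omega>. \<phi> (X u \<omega>, X s \<omega>) * m t (X s \<omega>) - \<phi> (X u \<omega>, X s \<omega>) * m r (X s \<omega>) \<partial>M)"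
    using m_props[OF st] m_props[OF \<open>s < r\<close>]
    by (intro Bochner_Integration.integral_diff[symmetric] int) auto
  finally have id: "(\<integral>\<omega>. (indicator A (X s \<omega>) - indicator A (X u \<omega>)) * (indicator A (X t \<omega>) - indicator A (X r \<omega>)) \<partial>M)
    = (\<integral>\<omega>. \<phi> (X u \<omega>, X s \<omega>) * m t (X s \<omega>) - \<phi> (X u \<omega>, X s \<omega>) * m r (X s \<omega>) \<partial>M)" (is "?E = ?E'") .
  define K where "K = exp 1 * Gamma (\<alpha> + \<beta>) * (t - r) * (r - s) powr (- 1 - \<beta> / \<alpha>)"
  have K: "K \<ge> 0" using assms Gamma_real_pos[of "\<alpha> + \<beta>"] \<alpha> by (simp add: K_def)
  have "ennreal \<bar>?E'\<bar> \<le> (\<integral>\<^sup>+\<omega>. ennreal (norm (\<phi> (X u \<omega>, X s \<omega>) * m t (X s \<omega>) - \<phi> (X u \<omega>, X s \<omega>) * m r (X s \<omega>))) \<partial>M)"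
    unfolding real_norm_def by (rule ennreal_abs_integral_le)
  also have "\<dots> \<le> (\<integral>\<^sup>+\<omega>. ennreal K * ennreal (\<bar>indicator A (X s \<omega>) - indicator A (X u \<omega>)\<bar> * \<bar>X s \<omega> - X u \<omega>\<bar> powr \<beta>) \<partial>M)"
  proof (intro nn_integral_mono)
    fix \<omega>
    let ?x = "X s \<omega>" and ?g = "\<bar>indicator A (X s \<omega>) - indicator A (X u \<omega>) :: real\<bar>"
    have Lt: "stable_law \<alpha> (t - s) (L t)" "stable_law \<alpha> (r - s) (L r)"
      unfolding L_def using assms by (auto intro!: stable_law_increment)
    \<comment> \<open>Translation by \<open>- X s\<close> moves the endpoint of the ray to
      \<open>c - X s\<close>, the place where the tails are compared.\<close>
    have "{v. ?x + v \<in> A} = {c - ?x..} \<or> {v. ?x + v \<in> A} = {c - ?x<..}"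
      using A by (auto simp: ray_def)
    then have "\<bar>m t ?x - m r ?x\<bar> \<le> exp 1 * Gamma (\<alpha> + \<beta>) * \<bar>c - ?x\<bar> powr \<beta> * ((t - s) - (r - s)) * (r - s) powr (- 1 - \<beta> / \<alpha>)"
      unfolding m_def using assms \<alpha> by (intro stable_law_tail_diff[OF Lt]) auto
    also have "\<dots> = K * \<bar>c - ?x\<bar> powr \<beta>" by (simp add: K_def)
    finally have md: "\<bar>m t ?x - m r ?x\<bar> \<le> K * \<bar>c - ?x\<bar> powr \<beta>" .
    have "norm (\<phi> (X u \<omega>, ?x) * m t ?x - \<phi> (X u \<omega>, ?x) * m r ?x) = ?g * \<bar>m t ?x - m r ?x\<bar>"
      by (simp add: \<phi>_def right_diff_distrib[symmetric] abs_mult)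
    also have "\<dots> \<le> ?g * (K * \<bar>c - ?x\<bar> powr \<beta>)" by (intro mult_left_mono md) simp
    also have "\<dots> \<le> ?g * (K * \<bar>?x - X u \<omega>\<bar> powr \<beta>)"
    proof (cases "?g = 0")
      case False
      then have "?x \<in> {c - \<bar>?x - X u \<omega>\<bar>..c + \<bar>?x - X u \<omega>\<bar>}"
        using ray_crossing(2)[OF A, of ?x "X u \<omega>"] by (auto split: split_indicator_asm)
      then have "\<bar>c - ?x\<bar> powr \<beta> \<le> \<bar>?x - X u \<omega>\<bar> powr \<beta>"
        using assms by (intro powr_mono2) auto
      then show ?thesis using K by (intro mult_left_mono) auto
    qed simp
    finally have "norm (\<phi> (X u \<omega>, ?x) * m t ?x - \<phi> (X u \<omega>, ?x) * m r ?x) \<le> K * (?g * \<bar>?x - X u \<omega>\<bar> powr \<beta>)"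
      by (simp add: mult_ac)
    then show "ennreal (norm (\<phi> (X u \<omega>, ?x) * m t ?x - \<phi> (X u \<omega>, ?x) * m r ?x))
      \<le> ennreal K * ennreal (?g * \<bar>?x - X u \<omega>\<bar> powr \<beta>)"
      using K by (simp add: ennreal_mult[symmetric] ennreal_leI)
  qed
  also have "\<dots> = ennreal K * (\<integral>\<^sup>+\<omega>. ennreal (\<bar>indicator A (X s \<omega>) - indicator A (X u \<omega>)\<bar> * \<bar>X s \<omega> - X u \<omega>\<bar> powr \<beta>) \<partial>M)"
    by (intro nn_integral_cmult) measurable
  also have "\<dots> \<le> ennreal K * ennreal B" by (intro mult_left_mono B) simp
  finally have "ennreal \<bar>?E'\<bar> \<le> ennreal (K * B)" using K \<open>0 \<le> B\<close> by (simp add: ennreal_mult)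
  then have "\<bar>?E'\<bar> \<le> K * B" using K \<open>0 \<le> B\<close> by (simp add: ennreal_le_iff)
  then show ?thesis unfolding id by (simp add: K_def)
qed

text \<open>Near the diagonal the second factor is bounded by 1 and the crossing probability of the
  first remains. Away from it the tail comparison contributes
  \<open>\<Delta> * (t - s) powr (- 1 - \<beta> / \<alpha>)\<close>, up to a constant, and the
  crossing moment contributes the missing \<open>\<Delta> powr (\<beta> / \<alpha>)\<close>.\<close>

lemma covariance_bound:
  assumes \<beta>: "0 < \<beta>" "1 + \<beta> < \<alpha>"
  obtains C where "0 \<le> C"
    "\<And>c A (u::real) (s::real) (r::real) (t::real) \<Delta>. ray c A \<Longrightarrow> 0 < \<Delta> \<Longrightarrow> u = 0 \<or> \<Delta> \<le> u \<Longrightarrow> u \<le> s \<Longrightarrow> s < u + \<Delta> \<Longrightarrow>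
      0 \<le> r \<Longrightarrow> r \<le> t \<Longrightarrow> t < r + \<Delta> \<Longrightarrow> 0 < s \<Longrightarrow> s \<le> t \<Longrightarrow>
      \<bar>\<integral>\<omega>. (indicator A (X s \<omega>) - indicator A (X u \<omega>)) * (indicator A (X t \<omega>) - indicator A (X r \<omega>)) \<partial>M\<bar>
      \<le> C * (\<Delta> / s) powr (1 / \<alpha>) * (if t - s \<le> 2 * \<Delta> then 1 else (\<Delta> / (t - s)) powr (1 + \<beta> / \<alpha>))"
proof -
  obtain C0 where C0: "0 \<le> C0"
    "\<And>c A (u::real) (s::real) \<Delta>. ray c A \<Longrightarrow> 0 < \<Delta> \<Longrightarrow> u = 0 \<or> \<Delta> \<le> u \<Longrightarrow> u \<le> s \<Longrightarrow> s < u + \<Delta> \<Longrightarrow> 0 < s \<Longrightarrow>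
      (\<integral>\<^sup>+\<omega>. ennreal (\<bar>indicator A (X s \<omega>) - indicator A (X u \<omega>)\<bar> * \<bar>X s \<omega> - X u \<omega>\<bar> powr 0) \<partial>M)
      \<le> ennreal (C0 * (\<Delta> / s) powr (1 / \<alpha>) * \<Delta> powr (0 / \<alpha>))"
    using crossing_moment_bound[of 0] \<alpha> by auto
  obtain C1 where C1: "0 \<le> C1"
    "\<And>c A (u::real) (s::real) \<Delta>. ray c A \<Longrightarrow> 0 < \<Delta> \<Longrightarrow> u = 0 \<or> \<Delta> \<le> u \<Longrightarrow> u \<le> s \<Longrightarrow> s < u + \<Delta> \<Longrightarrow> 0 < s \<Longrightarrow>
      (\<integral>\<^sup>+\<omega>. ennreal (\<bar>indicator A (X s \<omega>) - indicator A (X u \<omega>)\<bar> * \<bar>X s \<omega> - X u \<omega>\<bar> powr \<beta>) \<partial>M)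
      \<le> ennreal (C1 * (\<Delta> / s) powr (1 / \<alpha>) * \<Delta> powr (\<beta> / \<alpha>))"
    using crossing_moment_bound[of \<beta>] \<beta> by auto
  define K where "K = exp 1 * Gamma (\<alpha> + \<beta>)"
  have K: "0 \<le> K" using Gamma_real_pos[of "\<alpha> + \<beta>"] \<alpha> \<beta> by (simp add: K_def)
  define p where "p = 1 + \<beta> / \<alpha>"
  have p: "1 < p" using \<alpha> \<beta> by (simp add: p_def)
  \<comment> \<open>The factor \<open>2 powr p\<close> pays for replacing \<open>r - s\<close> by
    \<open>(t - s) / 2\<close>.\<close>
  define C2 where "C2 = K * 2 powr p * C1"
  have C2: "0 \<le> C2" using K C1 by (simp add: C2_def)
  show thesis
  proof (rule that[of "C0 + C2"])
    show "0 \<le> C0 + C2" using C0 C2 by simp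
    fix c A and u s r t \<Delta> :: real
    assume A: "ray c A" and \<Delta>: "0 < \<Delta>" and u: "u = 0 \<or> \<Delta> \<le> u" "u \<le> s" "s < u + \<Delta>"
      and r: "0 \<le> r" "r \<le> t" "t < r + \<Delta>" and s: "0 < s" "s \<le> t"
    let ?E = "\<integral>\<omega>. (indicator A (X s \<omega>) - indicator A (X u \<omega>)) * (indicator A (X t \<omega>) - indicator A (X r \<omega>)) \<partial>M"
    have u0: "0 \<le> u" using u \<Delta> by auto
    note [measurable] = ray_borel[OF A]
    have [measurable]: "X u \<in> borel_measurable M" "X s \<in> borel_measurable M" "X r \<in> borel_measurable M" "X t \<in> borel_measurable M"
      using u0 r s by (auto intro: measurable_X)
    show "\<bar>?E\<bar> \<le> (C0 + C2) * (\<Delta> / s) powr (1 / \<alpha>) * (if t - s \<le> 2 * \<Delta> then 1 else (\<Delta> / (t - s)) powr (1 + \<beta> / \<alpha>))"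
    proof (cases "t - s \<le> 2 * \<Delta>")
      case True
      have "ennreal \<bar>?E\<bar> \<le> (\<integral>\<^sup>+\<omega>. ennreal (norm ((indicator A (X s \<omega>) - indicator A (X u \<omega>) :: real) * (indicator A (X t \<omega>) - indicator A (X r \<omega>)))) \<partial>M)"
        unfolding real_norm_def by (rule ennreal_abs_integral_le)
      \<comment> \<open>The factor \<open>powr 0\<close> equals 1 unless \<open>X s = X u\<close>;
        in that case it is 0, but so is the first difference of indicators.\<close>
      also have "\<dots> \<le> (\<integral>\<^sup>+\<omega>. ennreal (\<bar>indicator A (X s \<omega>) - indicator A (X u \<omega>)\<bar> * \<bar>X s \<omega> - X u \<omega>\<bar> powr 0) \<partial>M)"
        by (intro nn_integral_mono ennreal_leI) (auto split: split_indicator)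
      also have "\<dots> \<le> ennreal (C0 * (\<Delta> / s) powr (1 / \<alpha>) * \<Delta> powr (0 / \<alpha>))"
        by (rule C0(2)[OF A \<Delta> u s(1)])
      finally have "\<bar>?E\<bar> \<le> C0 * (\<Delta> / s) powr (1 / \<alpha>)"
        using C0(1) \<Delta> by (simp add: ennreal_le_iff)
      also have "\<dots> \<le> (C0 + C2) * (\<Delta> / s) powr (1 / \<alpha>)" using C2 by (intro mult_right_mono) auto
      finally show ?thesis using True by simp
    next
      case False
      let ?h = "t - s"
      have h: "?h > 2 * \<Delta>" "?h > 0" using False \<Delta> by auto
      \<comment> \<open>Since \<open>t - r < \<Delta>\<close> and
        \<open>2 * \<Delta> < t - s\<close>, the gap that remains before \<open>r\<close> is at
        least half of \<open>t - s\<close>.\<close>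
      have rs: "?h / 2 \<le> r - s" using h r by simp
      define B where "B = C1 * (\<Delta> / s) powr (1 / \<alpha>) * \<Delta> powr (\<beta> / \<alpha>)"
      have B: "0 \<le> B" using C1 by (simp add: B_def)
      have "\<bar>?E\<bar> \<le> exp 1 * Gamma (\<alpha> + \<beta>) * (t - r) * (r - s) powr (- 1 - \<beta> / \<alpha>) * B"
      proof (rule integral_past_ray_diff[OF A u0 u(2) _ r(2) _ _ B])
        show "s < r" using rs h by simp
      qed (use \<beta> \<alpha> C1(2)[OF A \<Delta> u s(1)] in \<open>auto simp: B_def\<close>)
      also have "\<dots> \<le> K * \<Delta> * (?h / 2) powr (- p) * B"
      proof (unfold K_def[symmetric], intro mult_right_mono mult_mono)
        show "(r - s) powr (- 1 - \<beta> / \<alpha>) \<le> (?h / 2) powr (- p)"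
        proof -
          have "- 1 - \<beta> / \<alpha> = - p" by (simp add: p_def)
          then show ?thesis using rs h p by (auto intro!: powr_mono2')
        qed
      qed (use K r \<Delta> B in auto)
      also have "\<dots> = C2 * (\<Delta> / s) powr (1 / \<alpha>) * (\<Delta> / ?h) powr p"
      proof -
        have 1: "(?h / 2) powr (- p) = 2 powr p / ?h powr p"
          using h powr_minus_divide[of "?h / 2" p] by (simp add: powr_divide)
        have 2: "\<Delta> * \<Delta> powr (\<beta> / \<alpha>) = \<Delta> powr p"
          using \<Delta> by (simp add: p_def powr_add)
        have 3: "(\<Delta> / ?h) powr p = \<Delta> powr p / ?h powr p"
          using h \<Delta> by (simp add: powr_divide)
        have "K * \<Delta> * (?h / 2) powr (- p) * B = K * C1 * (\<Delta> / s) powr (1 / \<alpha>) * (\<Delta> * \<Delta> powr (\<beta> / \<alpha>)) * (?h / 2) powr (- p)"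
          by (simp add: B_def)
        also have "\<dots> = C2 * (\<Delta> / s) powr (1 / \<alpha>) * (\<Delta> / ?h) powr p"
          unfolding 1 2 3 C2_def by simp
        finally show ?thesis .
      qed
      also have "\<dots> \<le> (C0 + C2) * (\<Delta> / s) powr (1 / \<alpha>) * (\<Delta> / ?h) powr p"
        using C0 by (intro mult_right_mono) auto
      finally show ?thesis using False by (simp add: p_def)
    qed
  qed
qed

end

section \<open>The integrated error\<close>

text \<open>The part near the diagonal contributes \<open>2 * \<Delta>\<close>. The tail converges
  because \<open>p > 1\<close>; it is integrated from \<open>\<Delta>\<close> on, which is generous
  but keeps the constant simple.\<close>

lemma nn_integral_kernel_le:
  fixes \<Delta> p :: real
  assumes "0 < \<Delta>" "1 < p"
  shows "(\<integral>\<^sup>+h\<in>{0..}. ennreal (if h \<le> 2 * \<Delta> then 1 else (\<Delta> / h) powr p) \<partial>lborel)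
    \<le> ennreal ((2 + 1 / (p - 1)) * \<Delta>)"
proof -
  have "(\<integral>\<^sup>+h\<in>{0..}. ennreal (if h \<le> 2 * \<Delta> then 1 else (\<Delta> / h) powr p) \<partial>lborel)
    \<le> (\<integral>\<^sup>+h. indicator {0..2 * \<Delta>} h + ennreal (\<Delta> powr p) * (ennreal (h powr - p) * indicator {\<Delta>..} h) \<partial>lborel)"
    using assms
    by (intro nn_integral_mono)
      (auto split: split_indicator simp: powr_divide powr_minus_divide ennreal_mult[symmetric])
  also have "\<dots> = ennreal (2 * \<Delta>) + ennreal (\<Delta> powr p) * (\<integral>\<^sup>+h\<in>{\<Delta>..}. ennreal (h powr - p) \<partial>lborel)"
    using assms by (subst nn_integral_add) (auto simp: nn_integral_cmult)
  also have "(\<integral>\<^sup>+h\<in>{\<Delta>..}. ennreal (h powr - p) \<partial>lborel) = ennreal (- (\<Delta> powr (- p + 1)) / (- p + 1))"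
    using assms by (intro nn_integral_powr_to_inf) auto
  also have "- (\<Delta> powr (- p + 1)) / (- p + 1) = \<Delta> powr (1 - p) / (p - 1)"
    using assms by (simp add: field_simps)
  also have "ennreal (2 * \<Delta>) + ennreal (\<Delta> powr p) * ennreal (\<Delta> powr (1 - p) / (p - 1))
    = ennreal (2 * \<Delta> + \<Delta> powr p * (\<Delta> powr (1 - p) / (p - 1)))"
    using assms by (simp add: ennreal_mult[symmetric] ennreal_plus[symmetric] del: ennreal_plus)
  also have "2 * \<Delta> + \<Delta> powr p * (\<Delta> powr (1 - p) / (p - 1)) = (2 + 1 / (p - 1)) * \<Delta>"
    using assms powr_add[of \<Delta> p "1 - p"] by (simp add: distrib_right)
  finally show ?thesis .
qed

lemma nn_integral_scaled_powr:
  fixes \<Delta> T \<alpha> :: real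
  assumes "1 < \<alpha>" "0 < \<Delta>" "0 < T"
  shows "(\<integral>\<^sup>+s\<in>{0..T}. ennreal ((\<Delta> / s) powr (1 / \<alpha>)) \<partial>lborel)
    = ennreal (\<Delta> powr (1 / \<alpha>) * (T powr (1 - 1 / \<alpha>) / (1 - 1 / \<alpha>)))"
proof -
  have "(\<integral>\<^sup>+s\<in>{0..T}. ennreal ((\<Delta> / s) powr (1 / \<alpha>)) \<partial>lborel)
    = (\<integral>\<^sup>+s. ennreal (\<Delta> powr (1 / \<alpha>)) * (ennreal (s powr (- 1 / \<alpha>)) * indicator {0..T} s) \<partial>lborel)"
    using assms
    by (intro nn_integral_cong)
      (auto split: split_indicator simp: powr_divide powr_minus_divide ennreal_mult[symmetric])
  also have "\<dots> = ennreal (\<Delta> powr (1 / \<alpha>)) * ennreal (T powr (- 1 / \<alpha> + 1) / (- 1 / \<alpha> + 1))"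
    using assms nn_integral_powr_from_0[of "- 1 / \<alpha>" T] by (subst nn_integral_cmult) auto
  finally show ?thesis using assms by (simp add: ennreal_mult[symmetric])
qed

text \<open>This writes a Riemann sum as an integral, so that estimator and occupation time can be
  compared under one integral sign.\<close>

lemma integral_step_function:
  fixes f :: "nat \<Rightarrow> real" and \<Delta> :: real
  assumes "0 < \<Delta>"
  shows "(\<integral>t\<in>{0..real n * \<Delta>}. f (nat \<lfloor>t / \<Delta>\<rfloor>) \<partial>lborel) = \<Delta> * (\<Sum>k<n. f k)"
proof -
  \<comment> \<open>At the right end \<open>t = n * \<Delta>\<close> the floor is \<open>n\<close>,
    outside the range of the sum; this single point is a null set.\<close>
  have pt: "indicator {0..real n * \<Delta>} t *\<^sub>R f (nat \<lfloor>t / \<Delta>\<rfloor>)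
      = (\<Sum>k<n. f k * indicator {real k * \<Delta>..<real (Suc k) * \<Delta>} t)" if "t \<noteq> real n * \<Delta>" for t
  proof (cases "t \<in> {0..real n * \<Delta>}")
    case True
    let ?j = "nat \<lfloor>t / \<Delta>\<rfloor>"
    have t: "0 \<le> t / \<Delta>" "t / \<Delta> < real n" using True that assms by (auto simp: field_simps)
    have j: "?j < n" using t by (simp add: nat_less_iff floor_less_iff)
    have ind: "indicator {real k * \<Delta>..<real (Suc k) * \<Delta>} t = (if k = ?j then 1 else 0 :: real)" for k
    proof -
      have "t \<in> {real k * \<Delta>..<real (Suc k) * \<Delta>} \<longleftrightarrow> real k \<le> t / \<Delta> \<and> t / \<Delta> < real k + 1"
        using assms by (auto simp: field_simps)
      also have "\<dots> \<longleftrightarrow> \<lfloor>t / \<Delta>\<rfloor> = int k" by (simp add: floor_eq_iff)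
      also have "\<dots> \<longleftrightarrow> k = ?j" using t by auto
      finally show ?thesis by (simp add: indicator_def)
    qed
    have "(\<Sum>k<n. f k * indicator {real k * \<Delta>..<real (Suc k) * \<Delta>} t) = (\<Sum>k<n. if k = ?j then f k else 0)"
      unfolding ind by (intro sum.cong refl) simp
    then show ?thesis using True j by simp
  next
    case False
    have "indicator {real k * \<Delta>..<real (Suc k) * \<Delta>} t = (0 :: real)" if "k < n" for k
    proof -
      have "real (Suc k) * \<Delta> \<le> real n * \<Delta>" "0 \<le> real k * \<Delta>"
        using that assms by (auto intro: mult_right_mono)
      then show ?thesis using False by (auto split: split_indicator)
    qed
    then show ?thesis using False by simp
  qed
  have "(\<integral>t\<in>{0..real n * \<Delta>}. f (nat \<lfloor>t / \<Delta>\<rfloor>) \<partial>lborel)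
      = (\<integral>t. (\<Sum>k<n. f k * indicator {real k * \<Delta>..<real (Suc k) * \<Delta>} t) \<partial>lborel)"
    unfolding set_lebesgue_integral_def
  proof (rule integral_cong_AE)
    have "AE t in lborel. t \<noteq> real n * \<Delta>" by (rule AE_lborel_singleton)
    then show "AE t in lborel. indicator {0..real n * \<Delta>} t *\<^sub>R f (nat \<lfloor>t / \<Delta>\<rfloor>)
      = (\<Sum>k<n. f k * indicator {real k * \<Delta>..<real (Suc k) * \<Delta>} t)"
      by eventually_elim (rule pt)
  qed measurable
  also have "\<dots> = (\<Sum>k<n. (\<integral>t. f k * indicator {real k * \<Delta>..<real (Suc k) * \<Delta>} t \<partial>lborel))"
    using assms by (intro Bochner_Integration.integral_sum integrable_mult_right integrable_real_indicator) auto
  also have "\<dots> = (\<Sum>k<n. f k * \<Delta>)"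
    using assms by (intro sum.cong refl) (simp add: mult_right_mono algebra_simps)
  finally show ?thesis by (simp add: sum_distrib_left mult.commute)
qed

text \<open>The square of an integral is a double integral, and two uses of Fubini bring the
  expectation inside. Boundedness of \<open>D\<close> and finiteness of both measures justify the
  exchanges; absolute values are taken only afterwards, outside the expectation.\<close>

lemma (in prob_space) second_moment_integral_le:
  fixes D :: "'b \<Rightarrow> 'a \<Rightarrow> real"
  assumes N: "finite_measure N" and D[measurable]: "(\<lambda>(t, \<omega>). D t \<omega>) \<in> borel_measurable (N \<Otimes>\<^sub>M M)"
    and bnd: "\<And>t \<omega>. \<bar>D t \<omega>\<bar> \<le> 1"
  shows "ennreal (\<integral>\<omega>. (\<integral>t. D t \<omega> \<partial>N)\<^sup>2 \<partial>M)
    \<le> (\<integral>\<^sup>+s. (\<integral>\<^sup>+t. ennreal \<bar>\<integral>\<omega>. D s \<omega> * D t \<omega> \<partial>M\<bar> \<partial>N) \<partial>N)"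
proof -
  interpret N: finite_measure N by fact
  interpret P: pair_sigma_finite M N ..
  interpret Q: pair_sigma_finite N M ..
  interpret F: finite_measure "M \<Otimes>\<^sub>M N"
    by (intro finite_measure_pair_measure finite_measure_axioms N)
  define G where "G \<omega> = (\<integral>t. D t \<omega> \<partial>N)" for \<omega>
  define c where "c = measure N (space N)"
  have c: "c \<ge> 0" by (simp add: c_def)
  have [measurable]: "G \<in> borel_measurable M" unfolding G_def by measurable
  have G: "\<bar>G \<omega>\<bar> \<le> c" if "\<omega> \<in> space M" for \<omega>
  proof -
    have "\<bar>G \<omega>\<bar> \<le> (\<integral>t. \<bar>D t \<omega>\<bar> \<partial>N)"
      unfolding G_def by (rule integral_abs_bound)
    also have "\<dots> \<le> (\<integral>t. 1 \<partial>N)"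
      using that by (intro integral_mono N.integrable_const_bound[where B=1]) (auto simp: bnd)
    finally show ?thesis by (simp add: c_def)
  qed
  have "(\<integral>\<omega>. (\<integral>t. D t \<omega> \<partial>N)\<^sup>2 \<partial>M) = (\<integral>\<omega>. (\<integral>s. D s \<omega> * G \<omega> \<partial>N) \<partial>M)"
    by (simp add: G_def power2_eq_square)
  also have "\<dots> = (\<integral>s. (\<integral>\<omega>. D s \<omega> * G \<omega> \<partial>M) \<partial>N)"
  proof (rule P.Fubini_integral[symmetric])
    show "integrable (M \<Otimes>\<^sub>M N) (\<lambda>(\<omega>, s). D s \<omega> * G \<omega>)"
    proof (rule F.integrable_const_bound[where B=c])
      show "AE x in M \<Otimes>\<^sub>M N. norm (case x of (\<omega>, s) \<Rightarrow> D s \<omega> * G \<omega>) \<le> c"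
        using G by (intro AE_I2) (auto simp: space_pair_measure abs_mult intro!: mult_le_one order_trans[OF mult_mono[OF bnd G]] c)
    qed measurable
  qed
  also have "\<dots> = (\<integral>s. (\<integral>t. (\<integral>\<omega>. D s \<omega> * D t \<omega> \<partial>M) \<partial>N) \<partial>N)"
  proof (intro Bochner_Integration.integral_cong refl)
    fix s assume [measurable]: "s \<in> space N"
    have "(\<integral>\<omega>. D s \<omega> * G \<omega> \<partial>M) = (\<integral>\<omega>. (\<integral>t. D s \<omega> * D t \<omega> \<partial>N) \<partial>M)"
      by (simp add: G_def)
    also have "\<dots> = (\<integral>t. (\<integral>\<omega>. D s \<omega> * D t \<omega> \<partial>M) \<partial>N)"
    proof (rule P.Fubini_integral[symmetric])
      show "integrable (M \<Otimes>\<^sub>M N) (\<lambda>(\<omega>, t). D s \<omega> * D t \<omega>)"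
      proof (rule F.integrable_const_bound[where B=1])
        show "AE x in M \<Otimes>\<^sub>M N. norm (case x of (\<omega>, t) \<Rightarrow> D s \<omega> * D t \<omega>) \<le> 1"
          using bnd by (intro AE_I2) (auto simp: abs_mult intro!: mult_le_one)
      qed measurable
    qed
    finally show "(\<integral>\<omega>. D s \<omega> * G \<omega> \<partial>M) = (\<integral>t. (\<integral>\<omega>. D s \<omega> * D t \<omega> \<partial>M) \<partial>N)" .
  qed
  finally have eq: "(\<integral>\<omega>. (\<integral>t. D t \<omega> \<partial>N)\<^sup>2 \<partial>M) = (\<integral>s. (\<integral>t. (\<integral>\<omega>. D s \<omega> * D t \<omega> \<partial>M) \<partial>N) \<partial>N)" .
  have "ennreal (\<integral>\<omega>. (\<integral>t. D t \<omega> \<partial>N)\<^sup>2 \<partial>M) \<le> ennreal \<bar>\<integral>s. (\<integral>t. (\<integral>\<omega>. D s \<omega> * D t \<omega> \<partial>M) \<partial>N) \<partial>N\<bar>"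
    unfolding eq by (intro ennreal_leI) simp
  also have "\<dots> \<le> (\<integral>\<^sup>+s. ennreal \<bar>\<integral>t. (\<integral>\<omega>. D s \<omega> * D t \<omega> \<partial>M) \<partial>N\<bar> \<partial>N)"
    by (rule ennreal_abs_integral_le)
  also have "\<dots> \<le> (\<integral>\<^sup>+s. (\<integral>\<^sup>+t. ennreal \<bar>\<integral>\<omega>. D s \<omega> * D t \<omega> \<partial>M\<bar> \<partial>N) \<partial>N)"
    by (intro nn_integral_mono ennreal_abs_integral_le)
  finally show ?thesis .
qed

section \<open>Joint measurability of the paths\<close>

context sas_process
begin

text \<open>By right continuity the process is a pointwise limit of processes whose time is rounded
  up to multiples of \<open>1 / Suc m\<close>. Each of these uses only countably many times, hence
  is jointly measurable.\<close>

lemma measurable_path_process: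
  "(\<lambda>(t, \<omega>). X (max 0 t) \<omega>) \<in> borel_measurable (borel \<Otimes>\<^sub>M M)"
proof (rule borel_measurable_LIMSEQ_metric)
  fix m :: nat
  let ?i = "\<lambda>p :: real \<times> 'w. nat \<lfloor>real (Suc m) * max 0 (fst p)\<rfloor>"
  \<comment> \<open>The outer \<open>Suc\<close> keeps the rounded time strictly to the right of
    \<open>t\<close>, as convergence along \<open>at_right t\<close> demands.\<close>
  show "(\<lambda>p. X (real (Suc (?i p)) / real (Suc m)) (snd p)) \<in> borel_measurable (borel \<Otimes>\<^sub>M M)"
  proof (rule measurable_compose_countable[where g="?i"])
    fix i
    have [measurable]: "X (real (Suc i) / real (Suc m)) \<in> borel_measurable M"
      by (intro measurable_X) simp
    show "(\<lambda>p. X (real (Suc i) / real (Suc m)) (snd p)) \<in> borel_measurable (borel \<Otimes>\<^sub>M M)"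
      by measurable
  qed measurable
next
  fix p :: "real \<times> 'w" assume p: "p \<in> space (borel \<Otimes>\<^sub>M M)"
  define t where "t = max 0 (fst p)"
  define \<omega> where "\<omega> = snd p"
  have t: "0 \<le> t" and \<omega>: "\<omega> \<in> space M" using p by (auto simp: t_def \<omega>_def space_pair_measure)
  let ?t = "\<lambda>m. real (Suc (nat \<lfloor>real (Suc m) * t\<rfloor>)) / real (Suc m)"
  have lo: "t < ?t m" and hi: "?t m \<le> t + 1 / real (Suc m)" for m
  proof -
    have "real (nat \<lfloor>real (Suc m) * t\<rfloor>) = of_int \<lfloor>real (Suc m) * t\<rfloor>"
      using t by simp
    then have "real (Suc m) * t < real (Suc (nat \<lfloor>real (Suc m) * t\<rfloor>))"
      "real (Suc (nat \<lfloor>real (Suc m) * t\<rfloor>)) \<le> real (Suc m) * t + 1"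
      by linarith+
    moreover have "t < k / N \<and> k / N \<le> t + 1 / N" if "0 < N" "N * t < k" "k \<le> N * t + 1" for N k :: real
      using that by (auto simp: field_simps)
    ultimately show "t < ?t m" "?t m \<le> t + 1 / real (Suc m)"
      by (simp_all del: of_nat_Suc)
  qed
  have "?t \<longlonglongrightarrow> t"
  proof (rule tendsto_sandwich[where f="\<lambda>_. t"])
    show "(\<lambda>m. t + 1 / real (Suc m)) \<longlonglongrightarrow> t"
      using tendsto_add[OF tendsto_const LIMSEQ_inverse_real_of_nat, of t] by (simp add: inverse_eq_divide)
  qed (use lo hi in \<open>auto intro!: always_eventually less_imp_le\<close>)
  then have "filterlim ?t (at_right t) sequentially"
    using lo by (auto simp: filterlim_at intro!: always_eventually less_imp_neq[THEN not_sym])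
  moreover have "((\<lambda>s. X s \<omega>) \<longlongrightarrow> X t \<omega>) (at_right t)"
    using sas t \<omega> by (auto simp: sas_levy_def continuous_within)
  ultimately have "(\<lambda>m. X (?t m) \<omega>) \<longlonglongrightarrow> X t \<omega>"
    by (rule filterlim_compose[rotated])
  then show "(\<lambda>m. X (real (Suc (nat \<lfloor>real (Suc m) * max 0 (fst p)\<rfloor>)) / real (Suc m)) (snd p)) \<longlonglongrightarrow> (case p of (t, \<omega>) \<Rightarrow> X (max 0 t) \<omega>)"
    by (simp add: t_def \<omega>_def case_prod_beta)
qed

end

section \<open>The observation grid and integration over \<open>[0,T]\<close>\<close>

text \<open>For \<open>t \<ge> 0\<close> and \<open>\<Delta> > 0\<close> this is the last
  observation time not after \<open>t\<close>.\<close>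

definition grid :: "real \<Rightarrow> real \<Rightarrow> real" where
  "grid \<Delta> t = real (nat \<lfloor>t / \<Delta>\<rfloor>) * \<Delta>"

lemma measurable_grid [measurable]: "grid \<Delta> \<in> borel_measurable borel"
  unfolding grid_def by measurable

lemma grid_bounds:
  assumes "0 < \<Delta>" "0 \<le> t"
  shows "grid \<Delta> t = 0 \<or> \<Delta> \<le> grid \<Delta> t" "0 \<le> grid \<Delta> t" "grid \<Delta> t \<le> t" "t < grid \<Delta> t + \<Delta>"
proof -
  let ?k = "real (nat \<lfloor>t / \<Delta>\<rfloor>)"
  have k: "?k = of_int \<lfloor>t / \<Delta>\<rfloor>" using assms by simp
  have "?k \<le> t / \<Delta>" "t / \<Delta> < ?k + 1" unfolding k by linarith+
  then have "?k * \<Delta> \<le> t" "t < (?k + 1) * \<Delta>"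
    using assms by (simp_all only: pos_le_divide_eq pos_divide_less_eq)
  then show "grid \<Delta> t \<le> t" "t < grid \<Delta> t + \<Delta>" by (simp_all only: grid_def distrib_right mult_1)
  have "nat \<lfloor>t / \<Delta>\<rfloor> = 0 \<or> 1 \<le> ?k" by linarith
  then show "grid \<Delta> t = 0 \<or> \<Delta> \<le> grid \<Delta> t"
  proof (elim disjE)
    assume "nat \<lfloor>t / \<Delta>\<rfloor> = 0"
    then show ?thesis by (simp only: grid_def of_nat_0 mult_zero_left simp_thms)
  next
    assume "1 \<le> ?k"
    then show ?thesis using mult_right_mono[of 1 ?k \<Delta>] assms by (simp add: grid_def)
  qed
  show "0 \<le> grid \<Delta> t" using assms by (simp add: grid_def)
qed

text \<open>Lebesgue measure on \<open>[0,T]\<close>, taken as a density so that the underlying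
  space stays \<open>UNIV\<close> with the Borel sets.\<close>

definition time_measure :: "real \<Rightarrow> real measure" where
  "time_measure T = density lborel (\<lambda>t. ennreal (indicator {0..T} t))"

lemma sets_time_measure [measurable_cong]: "sets (time_measure T) = sets borel"
  by (simp add: time_measure_def)

lemma space_time_measure [simp]: "space (time_measure T) = UNIV"
  by (simp add: time_measure_def)

lemma finite_measure_time_measure: "finite_measure (time_measure T)"
proof
  have "emeasure (time_measure T) (space (time_measure T)) = emeasure lborel {0..T}"
    by (simp add: time_measure_def emeasure_density ennreal_indicator)
  also have "\<dots> \<noteq> \<infinity>" by (cases "0 \<le> T") auto
  finally show "emeasure (time_measure T) (space (time_measure T)) \<noteq> \<infinity>" .
qed

lemma integral_time_measure:
  fixes f :: "real \<Rightarrow> real"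
  assumes "f \<in> borel_measurable borel"
  shows "(\<integral>t. f t \<partial>time_measure T) = (\<integral>t\<in>{0..T}. f t \<partial>lborel)"
  unfolding time_measure_def set_lebesgue_integral_def using assms by (subst integral_density) auto

lemma nn_integral_time_measure:
  assumes "f \<in> borel_measurable borel"
  shows "(\<integral>\<^sup>+t. f t \<partial>time_measure T) = (\<integral>\<^sup>+t\<in>{0..T}. f t \<partial>lborel)"
  unfolding time_measure_def using assms
  by (subst nn_integral_density) (auto simp: ennreal_indicator mult.commute)

lemma AE_time_measure: "AE t in time_measure T. 0 < t \<and> t \<le> T"
proof -
  have "AE t in lborel. t \<noteq> (0::real)" by (rule AE_lborel_singleton)
  then show ?thesis
    unfolding time_measure_def
    by (subst AE_density) (auto elim!: eventually_mono split: split_indicator_asm)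
qed

text \<open>For fixed \<open>s\<close> the shift \<open>h = t - s\<close>, with \<open>t\<close>
  allowed to range over the whole line, gives a multiple of \<open>\<Delta>\<close> uniformly in
  \<open>s\<close>. The outer integral of \<open>(\<Delta> / s) powr (1 / \<alpha>)\<close> is
  finite because \<open>1 / \<alpha> < 1\<close>; it supplies the remaining powers of
  \<open>\<Delta>\<close> and \<open>T\<close>.\<close>

lemma nn_integral_covariance_kernel_le:
  fixes C \<Delta> p T \<alpha> :: real
  assumes "0 < \<Delta>" "0 < T" "1 < p" "1 < \<alpha>" "0 \<le> C"
  defines "k \<equiv> \<lambda>h. if h \<le> 2 * \<Delta> then 1 else (\<Delta> / h) powr p"
  shows "(\<integral>\<^sup>+s. (\<integral>\<^sup>+t. ennreal (C * (\<Delta> / s) powr (1 / \<alpha>)) * (ennreal (k (t - s)) * indicator {0..} (t - s))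
      \<partial>time_measure T) \<partial>time_measure T)
    \<le> ennreal (C * (2 + 1 / (p - 1)) / (1 - 1 / \<alpha>) * (\<Delta> powr (1 + 1 / \<alpha>) * T powr (1 - 1 / \<alpha>)))"
proof -
  have [measurable]: "k \<in> borel_measurable borel" unfolding k_def by measurable
  define K where "K = (2 + 1 / (p - 1)) * \<Delta>"
  have K: "0 \<le> K" using assms by (simp add: K_def)
  have inner: "(\<integral>\<^sup>+t. ennreal (C * (\<Delta> / s) powr (1 / \<alpha>)) * (ennreal (k (t - s)) * indicator {0..} (t - s)) \<partial>time_measure T)
    \<le> ennreal C * ennreal K * ennreal ((\<Delta> / s) powr (1 / \<alpha>))" for s
  proof -
    have "(\<integral>\<^sup>+t. ennreal (k (t - s)) * indicator {0..} (t - s) \<partial>time_measure T)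
      \<le> (\<integral>\<^sup>+t. ennreal (k (t - s)) * indicator {0..} (t - s) \<partial>lborel)"
      by (subst nn_integral_time_measure) (auto intro!: nn_integral_mono split: split_indicator)
    also have "\<dots> = (\<integral>\<^sup>+h\<in>{0..}. ennreal (k h) \<partial>lborel)"
      by (subst nn_integral_real_affine[where c=1 and t=s]) auto
    also have "\<dots> \<le> ennreal K"
      unfolding k_def K_def using assms by (intro nn_integral_kernel_le)
    finally have *: "(\<integral>\<^sup>+t. ennreal (k (t - s)) * indicator {0..} (t - s) \<partial>time_measure T) \<le> ennreal K" .
    have "(\<integral>\<^sup>+t. ennreal (C * (\<Delta> / s) powr (1 / \<alpha>)) * (ennreal (k (t - s)) * indicator {0..} (t - s)) \<partial>time_measure T)
      = ennreal (C * (\<Delta> / s) powr (1 / \<alpha>)) * (\<integral>\<^sup>+t. ennreal (k (t - s)) * indicator {0..} (t - s) \<partial>time_measure T)"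
      by (intro nn_integral_cmult) measurable
    also have "\<dots> \<le> ennreal (C * (\<Delta> / s) powr (1 / \<alpha>)) * ennreal K"
      by (intro mult_left_mono *) simp
    also have "\<dots> = ennreal C * ennreal K * ennreal ((\<Delta> / s) powr (1 / \<alpha>))"
      using assms K by (simp add: ennreal_mult mult_ac)
    finally show ?thesis .
  qed
  have "(\<integral>\<^sup>+s. (\<integral>\<^sup>+t. ennreal (C * (\<Delta> / s) powr (1 / \<alpha>)) * (ennreal (k (t - s)) * indicator {0..} (t - s))
      \<partial>time_measure T) \<partial>time_measure T)
    \<le> (\<integral>\<^sup>+s. ennreal C * ennreal K * ennreal ((\<Delta> / s) powr (1 / \<alpha>)) \<partial>time_measure T)"
    by (intro nn_integral_mono inner)
  also have "\<dots> = ennreal C * ennreal K * (\<integral>\<^sup>+s\<in>{0..T}. ennreal ((\<Delta> / s) powr (1 / \<alpha>)) \<partial>lborel)"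
    by (subst nn_integral_cmult) (auto simp: nn_integral_time_measure)
  also have "\<dots> = ennreal C * ennreal K * ennreal (\<Delta> powr (1 / \<alpha>) * (T powr (1 - 1 / \<alpha>) / (1 - 1 / \<alpha>)))"
    using assms by (simp only: nn_integral_scaled_powr)
  also have "\<dots> = ennreal (C * K * (\<Delta> powr (1 / \<alpha>) * (T powr (1 - 1 / \<alpha>) / (1 - 1 / \<alpha>))))"
    using assms K by (simp add: ennreal_mult[symmetric])
  also have "C * K * (\<Delta> powr (1 / \<alpha>) * (T powr (1 - 1 / \<alpha>) / (1 - 1 / \<alpha>)))
    = C * (2 + 1 / (p - 1)) / (1 - 1 / \<alpha>) * (\<Delta> powr (1 + 1 / \<alpha>) * T powr (1 - 1 / \<alpha>))"
    using assms by (simp add: K_def powr_add)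
  finally show ?thesis .
qed

section \<open>The mean square error\<close>

context sas_process
begin

text \<open>The \<open>max 0\<close> is there because nothing is known about \<open>X\<close> at negative times.\<close>
definition jump :: "real set \<Rightarrow> real \<Rightarrow> real \<Rightarrow> 'w \<Rightarrow> real" where
  "jump A \<Delta> t \<omega> = indicator A (X (max 0 t) \<omega>) - indicator A (X (max 0 (grid \<Delta> t)) \<omega>)"

lemma abs_jump_le: "\<bar>jump A \<Delta> t \<omega>\<bar> \<le> 1"
  by (auto simp: jump_def split: split_indicator)

lemma measurable_jump [measurable (raw)]:
  assumes [measurable]: "A \<in> sets borel"
  shows "(\<lambda>(t, \<omega>). jump A \<Delta> t \<omega>) \<in> borel_measurable (time_measure T \<Otimes>\<^sub>M M)"
proof -
  note [measurable] = measurable_path_process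
  have "(\<lambda>p. (case (fst p, snd p) of (t, \<omega>) \<Rightarrow> X (max 0 t) \<omega>)) \<in> borel_measurable (borel \<Otimes>\<^sub>M M)"
    by measurable
  moreover have "(\<lambda>p. (case (grid \<Delta> (fst p), snd p) of (t, \<omega>) \<Rightarrow> X (max 0 t) \<omega>)) \<in> borel_measurable (borel \<Otimes>\<^sub>M M)"
    by measurable
  ultimately have [measurable]: "(\<lambda>p. X (max 0 (fst p)) (snd p)) \<in> borel_measurable (borel \<Otimes>\<^sub>M M)"
    "(\<lambda>p. X (max 0 (grid \<Delta> (fst p))) (snd p)) \<in> borel_measurable (borel \<Otimes>\<^sub>M M)"
    by simp_all
  have "(\<lambda>p. jump A \<Delta> (fst p) (snd p)) \<in> borel_measurable (borel \<Otimes>\<^sub>M M)"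
    unfolding jump_def by measurable
  moreover have "sets (time_measure T \<Otimes>\<^sub>M M) = sets (borel \<Otimes>\<^sub>M M)"
    by (intro sets_pair_measure_cong sets_time_measure refl)
  ultimately show ?thesis by (simp add: case_prod_beta cong: measurable_cong_sets)
qed

lemma measurable_path:
  assumes "\<omega> \<in> space M"
  shows "(\<lambda>t. X (max 0 t) \<omega>) \<in> borel_measurable borel"
  using measurable_compose[OF measurable_Pair2'[OF assms] measurable_path_process] by simp

text \<open>Occupation time and estimator are integrals over \<open>[0,T]\<close> of the same
  indicator, read at \<open>t\<close> and at \<open>grid \<Delta> t\<close>. The sign is negative
  because \<open>jump\<close> subtracts the value at the grid point.\<close>

lemma occ_error_eq:
  assumes [measurable]: "A \<in> sets borel" and T: "0 < T" and n: "1 \<le> n" and \<omega>: "\<omega> \<in> space M"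
  shows "occ_est X T n A \<omega> - occ_time X T A \<omega> = - (\<integral>t. jump A (T / real n) t \<omega> \<partial>time_measure T)"
proof -
  define \<Delta> where "\<Delta> = T / real n"
  have \<Delta>: "0 < \<Delta>" "real n * \<Delta> = T" using T n by (auto simp: \<Delta>_def)
  note path[measurable] = measurable_path[OF \<omega>]
  interpret N: finite_measure "time_measure T" by (rule finite_measure_time_measure)
  have [measurable]: "(\<lambda>t. X (max 0 (grid \<Delta> t)) \<omega>) \<in> borel_measurable borel"
    using measurable_compose[OF measurable_grid path] .
  have int: "integrable (time_measure T) (\<lambda>t. indicator A (X (max 0 t) \<omega>) :: real)"
    "integrable (time_measure T) (\<lambda>t. indicator A (X (max 0 (grid \<Delta> t)) \<omega>) :: real)"
    by (intro N.integrable_const_bound[where B=1]; auto)+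
  have "occ_time X T A \<omega> = (\<integral>t\<in>{0..T}. indicator A (X (max 0 t) \<omega>) \<partial>lborel)"
    unfolding occ_time_def by (intro set_lebesgue_integral_cong) (auto simp: max_def)
  also have "\<dots> = (\<integral>t. indicator A (X (max 0 t) \<omega>) \<partial>time_measure T)"
    by (subst integral_time_measure) auto
  finally have 1: "occ_time X T A \<omega> = (\<integral>t. indicator A (X (max 0 t) \<omega>) \<partial>time_measure T)" .
  \<comment> \<open>The sum over \<open>k = 1..n\<close> of values at index \<open>k - 1\<close>
    becomes a sum over \<open>k < n\<close>.\<close>
  have "occ_est X T n A \<omega> = \<Delta> * (\<Sum>k<n. indicator A (X (max 0 (real k * \<Delta>)) \<omega>))"
    unfolding occ_est_def \<Delta>_def[symmetric] using \<Delta>(1) by (simp add: sum.atLeast1_atMost_eq max_def)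
  also have "\<dots> = (\<integral>t\<in>{0..T}. indicator A (X (max 0 (grid \<Delta> t)) \<omega>) \<partial>lborel)"
    unfolding grid_def \<Delta>(2)[symmetric]
    by (rule integral_step_function[OF \<Delta>(1), of n "\<lambda>k. indicator A (X (max 0 (real k * \<Delta>)) \<omega>)", symmetric])
  also have "\<dots> = (\<integral>t. indicator A (X (max 0 (grid \<Delta> t)) \<omega>) \<partial>time_measure T)"
    by (subst integral_time_measure) auto
  finally show ?thesis
    unfolding 1 jump_def \<Delta>_def[symmetric] using int by simp
qed

lemma square_integrable_jump:
  assumes [measurable]: "A \<in> sets borel"
  shows "integrable M (\<lambda>\<omega>. (\<integral>t. jump A \<Delta> t \<omega> \<partial>time_measure T)\<^sup>2)"
proof -
  interpret N: finite_measure "time_measure T" by (rule finite_measure_time_measure)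
  let ?c = "measure (time_measure T) UNIV"
  have "\<bar>\<integral>t. jump A \<Delta> t \<omega> \<partial>time_measure T\<bar> \<le> ?c" if "\<omega> \<in> space M" for \<omega>
  proof -
    have [measurable]: "(\<lambda>t. jump A \<Delta> t \<omega>) \<in> borel_measurable (time_measure T)"
      using measurable_compose[OF measurable_Pair2'[OF that] measurable_jump[OF assms]] by simp
    have "\<bar>\<integral>t. jump A \<Delta> t \<omega> \<partial>time_measure T\<bar> \<le> (\<integral>t. \<bar>jump A \<Delta> t \<omega>\<bar> \<partial>time_measure T)"
      by (rule integral_abs_bound)
    also have "\<dots> \<le> (\<integral>t. 1 \<partial>time_measure T)"
      by (intro integral_mono N.integrable_const_bound[where B=1]) (auto simp: abs_jump_le)
    finally show ?thesis by simp
  qed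
  then have "\<bar>\<integral>t. jump A \<Delta> t \<omega> \<partial>time_measure T\<bar>\<^sup>2 \<le> ?c\<^sup>2" if "\<omega> \<in> space M" for \<omega>
    using that by (intro power_mono) auto
  moreover have "(\<lambda>\<omega>. (\<integral>t. jump A \<Delta> t \<omega> \<partial>time_measure T)\<^sup>2) \<in> borel_measurable M"
  proof -
    note [measurable] = measurable_jump[OF assms]
    show ?thesis by measurable
  qed
  ultimately show ?thesis
    by (intro integrable_const_bound[where B="?c\<^sup>2"]) (auto intro!: AE_I2)
qed

text \<open>The second moment is bounded by a double integral of covariances. Their bound is known
  for \<open>s \<le> t\<close> only, so it is added to its mirror image; by Fubini both have the
  same integral, which yields the factor 2.\<close>

lemma ray_error_bound:
  obtains C where "0 \<le> C"
    "\<And>c A \<Delta> T. ray c A \<Longrightarrow> 0 < \<Delta> \<Longrightarrow> 0 < T \<Longrightarrow>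
      (\<integral>\<omega>. (\<integral>t. jump A \<Delta> t \<omega> \<partial>time_measure T)\<^sup>2 \<partial>M) \<le> C * (\<Delta> powr (1 + 1 / \<alpha>) * T powr (1 - 1 / \<alpha>))"
proof -
  \<comment> \<open>The midpoint of the admissible range: \<open>\<beta> < \<alpha> - 1\<close>
    keeps the crossing moments finite, and \<open>\<beta> > 0\<close> makes
    \<open>p > 1\<close>.\<close>
  define \<beta> where "\<beta> = (\<alpha> - 1) / 2"
  have \<beta>: "0 < \<beta>" "1 + \<beta> < \<alpha>" using \<alpha> by (auto simp: \<beta>_def field_simps)
  define p where "p = 1 + \<beta> / \<alpha>"
  have p: "1 < p" using \<beta> \<alpha> by (simp add: p_def)
  obtain C where C: "0 \<le> C"
    "\<And>c A (u::real) (s::real) (r::real) (t::real) \<Delta>. ray c A \<Longrightarrow> 0 < \<Delta> \<Longrightarrow> u = 0 \<or> \<Delta> \<le> u \<Longrightarrow> u \<le> s \<Longrightarrow> s < u + \<Delta> \<Longrightarrow>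
      0 \<le> r \<Longrightarrow> r \<le> t \<Longrightarrow> t < r + \<Delta> \<Longrightarrow> 0 < s \<Longrightarrow> s \<le> t \<Longrightarrow>
      \<bar>\<integral>\<omega>. (indicator A (X s \<omega>) - indicator A (X u \<omega>)) * (indicator A (X t \<omega>) - indicator A (X r \<omega>)) \<partial>M\<bar>
      \<le> C * (\<Delta> / s) powr (1 / \<alpha>) * (if t - s \<le> 2 * \<Delta> then 1 else (\<Delta> / (t - s)) powr p)"
    using covariance_bound[OF \<beta>] unfolding p_def by blast
  define C' where "C' = C * (2 + 1 / (p - 1)) / (1 - 1 / \<alpha>)"
  have C': "0 \<le> C'" using C p \<alpha> by (simp add: C'_def)
  show thesis
  proof (rule that[of "2 * C'"])
    show "0 \<le> 2 * C'" using C' by simp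
    fix c A and \<Delta> T :: real
    assume A: "ray c A" and \<Delta>: "0 < \<Delta>" and T: "0 < T"
    note [measurable] = ray_borel[OF A]
    let ?N = "time_measure T"
    interpret N: finite_measure ?N by (rule finite_measure_time_measure)
    interpret P: pair_sigma_finite ?N ?N ..
    \<comment> \<open>The indicator of \<open>t - s \<ge> 0\<close> restricts the bound to one side
      of the diagonal.\<close>
    define B where "B s t = ennreal (C * (\<Delta> / s) powr (1 / \<alpha>)) *
      (ennreal (if t - s \<le> 2 * \<Delta> then 1 else (\<Delta> / (t - s)) powr p) * indicator {0..} (t - s))" for s t :: real
    have [measurable]: "(\<lambda>(s, t). B s t) \<in> borel_measurable (?N \<Otimes>\<^sub>M ?N)"
      unfolding B_def by measurable
    have R: "ennreal \<bar>\<integral>\<omega>. jump A \<Delta> s \<omega> * jump A \<Delta> t \<omega> \<partial>M\<bar> \<le> B s t"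
      if "0 < s" "s \<le> t" for s t
    proof -
      have t: "0 < t" using that by simp
      note g = grid_bounds[OF \<Delta> less_imp_le[OF that(1)]] grid_bounds[OF \<Delta> less_imp_le[OF t]]
      have "\<bar>\<integral>\<omega>. jump A \<Delta> s \<omega> * jump A \<Delta> t \<omega> \<partial>M\<bar>
        = \<bar>\<integral>\<omega>. (indicator A (X s \<omega>) - indicator A (X (grid \<Delta> s) \<omega>)) * (indicator A (X t \<omega>) - indicator A (X (grid \<Delta> t) \<omega>)) \<partial>M\<bar>"
        using that t g by (simp add: jump_def max_def)
      also have "\<dots> \<le> C * (\<Delta> / s) powr (1 / \<alpha>) * (if t - s \<le> 2 * \<Delta> then 1 else (\<Delta> / (t - s)) powr p)"
        by (intro C(2)[OF A \<Delta>] g that)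
      finally show ?thesis
        using that C(1) by (auto simp: B_def ennreal_mult[symmetric] intro!: ennreal_leI)
    qed
    have "ennreal (\<integral>\<omega>. (\<integral>t. jump A \<Delta> t \<omega> \<partial>?N)\<^sup>2 \<partial>M)
      \<le> (\<integral>\<^sup>+s. (\<integral>\<^sup>+t. ennreal \<bar>\<integral>\<omega>. jump A \<Delta> s \<omega> * jump A \<Delta> t \<omega> \<partial>M\<bar> \<partial>?N) \<partial>?N)"
      by (rule second_moment_integral_le[OF finite_measure_time_measure measurable_jump abs_jump_le]) measurable
    also have "\<dots> \<le> (\<integral>\<^sup>+s. (\<integral>\<^sup>+t. B s t + B t s \<partial>?N) \<partial>?N)"
    proof (rule nn_integral_mono_AE)
      show "AE s in ?N. (\<integral>\<^sup>+t. ennreal \<bar>\<integral>\<omega>. jump A \<Delta> s \<omega> * jump A \<Delta> t \<omega> \<partial>M\<bar> \<partial>?N) \<le> (\<integral>\<^sup>+t. B s t + B t s \<partial>?N)"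
        using AE_time_measure[of T]
      proof eventually_elim
        case (elim s)
        show ?case
        proof (rule nn_integral_mono_AE)
          show "AE t in ?N. ennreal \<bar>\<integral>\<omega>. jump A \<Delta> s \<omega> * jump A \<Delta> t \<omega> \<partial>M\<bar> \<le> B s t + B t s"
            using AE_time_measure[of T]
          proof eventually_elim
            case (elim t)
            show ?case
            proof (cases "s \<le> t")
              case True
              then show ?thesis using R[of s t] \<open>0 < s \<and> s \<le> T\<close> by (intro add_increasing2) auto
            next
              case False
              then show ?thesis using R[of t s] elim by (intro add_increasing) (auto simp: mult.commute)
            qed
          qed
        qed
      qed
    qed
    also have "\<dots> = (\<integral>\<^sup>+s. (\<integral>\<^sup>+t. B s t \<partial>?N) + (\<integral>\<^sup>+t. B t s \<partial>?N) \<partial>?N)"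
      by (intro nn_integral_cong nn_integral_add) measurable
    also have "\<dots> = (\<integral>\<^sup>+s. (\<integral>\<^sup>+t. B s t \<partial>?N) \<partial>?N) + (\<integral>\<^sup>+s. (\<integral>\<^sup>+t. B t s \<partial>?N) \<partial>?N)"
      by (intro nn_integral_add) measurable
    also have "(\<integral>\<^sup>+s. (\<integral>\<^sup>+t. B t s \<partial>?N) \<partial>?N) = (\<integral>\<^sup>+s. (\<integral>\<^sup>+t. B s t \<partial>?N) \<partial>?N)"
      by (rule P.Fubini') measurable
    also have "(\<integral>\<^sup>+s. (\<integral>\<^sup>+t. B s t \<partial>?N) \<partial>?N) + (\<integral>\<^sup>+s. (\<integral>\<^sup>+t. B s t \<partial>?N) \<partial>?N)
      \<le> ennreal (C' * (\<Delta> powr (1 + 1 / \<alpha>) * T powr (1 - 1 / \<alpha>))) + ennreal (C' * (\<Delta> powr (1 + 1 / \<alpha>) * T powr (1 - 1 / \<alpha>)))"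
      unfolding B_def C'_def by (intro add_mono nn_integral_covariance_kernel_le \<Delta> T p \<alpha> C)
    also have "\<dots> = ennreal (2 * C' * (\<Delta> powr (1 + 1 / \<alpha>) * T powr (1 - 1 / \<alpha>)))"
      using C' by (subst ennreal_plus[symmetric]) auto
    finally show "(\<integral>\<omega>. (\<integral>t. jump A \<Delta> t \<omega> \<partial>?N)\<^sup>2 \<partial>M) \<le> 2 * C' * (\<Delta> powr (1 + 1 / \<alpha>) * T powr (1 - 1 / \<alpha>))"
      using C' by (simp add: ennreal_le_iff)
  qed
qed

text \<open>The error is linear in the indicator, so the error for an interval is the difference of
  two ray errors. The factor 4 arises from
  \<open>(x - y)\<^sup>2 \<le> 2 * x\<^sup>2 + 2 * y\<^sup>2\<close> applied to two equal
  bounds.\<close>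

lemma occ_error_bound:
  obtains C where "0 \<le> C"
    "\<And>(a::ereal) (b::ereal) T n. a \<le> b \<Longrightarrow> 0 < T \<Longrightarrow> 1 \<le> n \<Longrightarrow>
      (\<integral>\<omega>. (occ_est X T n (ext_Icc a b) \<omega> - occ_time X T (ext_Icc a b) \<omega>)\<^sup>2 \<partial>M)
      \<le> C * ((T / real n) powr (1 + 1 / \<alpha>) * T powr (1 - 1 / \<alpha>))"
proof -
  obtain C where C: "0 \<le> C"
    "\<And>c A \<Delta> T. ray c A \<Longrightarrow> 0 < \<Delta> \<Longrightarrow> 0 < T \<Longrightarrow>
      (\<integral>\<omega>. (\<integral>t. jump A \<Delta> t \<omega> \<partial>time_measure T)\<^sup>2 \<partial>M) \<le> C * (\<Delta> powr (1 + 1 / \<alpha>) * T powr (1 - 1 / \<alpha>))"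
    using ray_error_bound by blast
  show thesis
  proof (rule that[of "4 * C"])
    show "0 \<le> 4 * C" using C by simp
    fix a b :: ereal and T :: real and n :: nat
    assume ab: "a \<le> b" and T: "0 < T" and n: "1 \<le> n"
    define \<Delta> where "\<Delta> = T / real n"
    have \<Delta>: "0 < \<Delta>" using T n by (simp add: \<Delta>_def)
    let ?N = "time_measure T"
    define V where "V = \<Delta> powr (1 + 1 / \<alpha>) * T powr (1 - 1 / \<alpha>)"
    have V: "0 \<le> V" by (simp add: V_def)
    define I where "I A \<omega> = (\<integral>t. jump A \<Delta> t \<omega> \<partial>?N)" for A \<omega>
    interpret N: finite_measure ?N by (rule finite_measure_time_measure)
    \<comment> \<open>An infinite endpoint makes the ray empty or the whole line, and then the error
      is 0.\<close>
    have triv: "I {} \<omega> = 0" "I UNIV \<omega> = 0" for \<omega> by (auto simp: I_def jump_def)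
    have bound: "(\<integral>\<omega>. (I A \<omega>)\<^sup>2 \<partial>M) \<le> C * V" if "A = {} \<or> A = UNIV \<or> (\<exists>c. ray c A)" for A
      using that C V \<Delta> T triv unfolding V_def by (auto simp: I_def)
    let ?H = "{x. a \<le> ereal x}" and ?K = "{x. b < ereal x}"
    have H: "?H = {} \<or> ?H = UNIV \<or> (\<exists>c. ray c ?H)" by (cases a) (auto simp: ray_def)
    have K: "?K = {} \<or> ?K = UNIV \<or> (\<exists>c. ray c ?K)" by (cases b) (auto simp: ray_def)
    have HK[measurable]: "?H \<in> sets borel" "?K \<in> sets borel"
      using H K ray_borel by (auto simp del: Collect_empty_eq)
    \<comment> \<open>Because \<open>a \<le> b\<close>, the set \<open>?K\<close> is contained in
      \<open>?H\<close>, so the set difference becomes a difference of indicators.\<close>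
    have ind: "indicator (ext_Icc a b) x = (indicator ?H x - indicator ?K x :: real)" for x
      using ab by (auto simp: ext_Icc_def indicator_def)
    have "ext_Icc a b = ?H - ?K" using ab by (auto simp: ext_Icc_def)
    then have Icc[measurable]: "ext_Icc a b \<in> sets borel" by simp
    have split: "occ_est X T n (ext_Icc a b) \<omega> - occ_time X T (ext_Icc a b) \<omega> = I ?K \<omega> - I ?H \<omega>"
      if \<omega>: "\<omega> \<in> space M" for \<omega>
    proof -
      have int: "integrable ?N (\<lambda>t. jump A \<Delta> t \<omega>)" if "A \<in> sets borel" for A
      proof (rule N.integrable_const_bound[where B=1])
        show "(\<lambda>t. jump A \<Delta> t \<omega>) \<in> borel_measurable ?N"
          using measurable_compose[OF measurable_Pair2'[OF \<omega>] measurable_jump[OF that]] by simp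
      qed (simp add: abs_jump_le)
      have "jump (ext_Icc a b) \<Delta> t \<omega> = jump ?H \<Delta> t \<omega> - jump ?K \<Delta> t \<omega>" for t
        by (simp add: jump_def ind)
      then have "I (ext_Icc a b) \<omega> = I ?H \<omega> - I ?K \<omega>"
        unfolding I_def using int HK by simp
      then show ?thesis
        using occ_error_eq[OF Icc T n \<omega>] by (simp add: I_def \<Delta>_def)
    qed
    have sq: "(x - y)\<^sup>2 \<le> 2 * x\<^sup>2 + 2 * y\<^sup>2" for x y :: real
      using zero_le_power2[of "x + y"] by (simp add: power2_eq_square algebra_simps)
    have int2: "integrable M (\<lambda>\<omega>. (I A \<omega>)\<^sup>2)" if "A \<in> sets borel" for A
      unfolding I_def by (rule square_integrable_jump[OF that])
    have "(\<integral>\<omega>. (occ_est X T n (ext_Icc a b) \<omega> - occ_time X T (ext_Icc a b) \<omega>)\<^sup>2 \<partial>M)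
      = (\<integral>\<omega>. (I ?K \<omega> - I ?H \<omega>)\<^sup>2 \<partial>M)"
      by (intro Bochner_Integration.integral_cong refl) (simp add: split)
    also have "\<dots> \<le> (\<integral>\<omega>. 2 * (I ?K \<omega>)\<^sup>2 + 2 * (I ?H \<omega>)\<^sup>2 \<partial>M)"
      by (intro integral_mono' Bochner_Integration.integrable_add integrable_mult_right int2 HK sq) auto
    also have "\<dots> = 2 * (\<integral>\<omega>. (I ?K \<omega>)\<^sup>2 \<partial>M) + 2 * (\<integral>\<omega>. (I ?H \<omega>)\<^sup>2 \<partial>M)"
      using int2[OF HK(1)] int2[OF HK(2)] by simp
    also have "\<dots> \<le> 4 * C * V" using bound[OF H] bound[OF K] by simp
    finally show "(\<integral>\<omega>. (occ_est X T n (ext_Icc a b) \<omega> - occ_time X T (ext_Icc a b) \<omega>)\<^sup>2 \<partial>M)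
      \<le> 4 * C * ((T / real n) powr (1 + 1 / \<alpha>) * T powr (1 - 1 / \<alpha>))"
      by (simp add: V_def \<Delta>_def)
  qed
qed

end

section \<open>Normalisation by the step size\<close>

theorem theorem2:
  fixes M :: "'w measure" and \<alpha> :: real and X :: "real \<Rightarrow> 'w \<Rightarrow> real"
  assumes "1 < \<alpha>" and "\<alpha> \<le> 2" and "sas_levy M \<alpha> X"
  shows "\<exists>\<epsilon>0>0. \<forall>\<epsilon>. 0 < \<epsilon> \<and> \<epsilon> < \<epsilon>0 \<longrightarrow>
           (\<exists>C::real. \<forall>(a::ereal) (b::ereal) (T::real) (n::nat).
              a \<le> b \<and> 0 < T \<and> 1 \<le> n \<longrightarrow>
              (T / real n) powr (-1 - 1 / \<alpha>) *
                (\<integral>\<omega>. (occ_est X T n (ext_Icc a b) \<omega> - occ_time X T (ext_Icc a b) \<omega>)\<^sup>2 \<partial>M)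
              \<le> C * max 1 (T powr (-\<epsilon>)) * T powr (1 - 1 / \<alpha>))"
proof -
  interpret sas_process M \<alpha> X
    using assms by unfold_locales
  obtain C where C: "0 \<le> C"
    "\<And>(a::ereal) (b::ereal) T n. a \<le> b \<Longrightarrow> 0 < T \<Longrightarrow> 1 \<le> n \<Longrightarrow>
      (\<integral>\<omega>. (occ_est X T n (ext_Icc a b) \<omega> - occ_time X T (ext_Icc a b) \<omega>)\<^sup>2 \<partial>M)
      \<le> C * ((T / real n) powr (1 + 1 / \<alpha>) * T powr (1 - 1 / \<alpha>))"
    using occ_error_bound by blast
  have main: "(T / real n) powr (-1 - 1 / \<alpha>) *
       (\<integral>\<omega>. (occ_est X T n (ext_Icc a b) \<omega> - occ_time X T (ext_Icc a b) \<omega>)\<^sup>2 \<partial>M)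
     \<le> C * max 1 (T powr (-\<epsilon>)) * T powr (1 - 1 / \<alpha>)"
    if "a \<le> b" "0 < T" "1 \<le> n" for a b :: ereal and T \<epsilon> :: real and n :: nat
  proof -
    let ?\<Delta> = "T / real n"
    have \<Delta>: "0 < ?\<Delta>" using that by simp
    have "?\<Delta> powr (-1 - 1 / \<alpha>) * (\<integral>\<omega>. (occ_est X T n (ext_Icc a b) \<omega> - occ_time X T (ext_Icc a b) \<omega>)\<^sup>2 \<partial>M)
      \<le> ?\<Delta> powr (-1 - 1 / \<alpha>) * (C * (?\<Delta> powr (1 + 1 / \<alpha>) * T powr (1 - 1 / \<alpha>)))"
      by (intro mult_left_mono C(2) that) simp
    also have "\<dots> = C * (?\<Delta> powr (-1 - 1 / \<alpha>) * ?\<Delta> powr (1 + 1 / \<alpha>)) * T powr (1 - 1 / \<alpha>)"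
      by (simp only: mult_ac)
    also have "?\<Delta> powr (-1 - 1 / \<alpha>) * ?\<Delta> powr (1 + 1 / \<alpha>) = 1"
      using that by (subst powr_add[symmetric]) simp
    also have "C * 1 * T powr (1 - 1 / \<alpha>) \<le> C * max 1 (T powr (-\<epsilon>)) * T powr (1 - 1 / \<alpha>)"
      using C(1) by (intro mult_right_mono mult_left_mono) auto
    finally show ?thesis .
  qed
  \<comment> \<open>Any positive number may serve as the bound on \<open>\<epsilon>\<close>, since
    \<open>main\<close> holds with the same \<open>C\<close> for each \<open>\<epsilon>\<close>; the
    value 1 is a convenient choice.\<close>
  show ?thesis
    by (intro exI[of _ 1] conjI allI impI exI[of _ C]) (auto intro!: main)
qed

end
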